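(* Let $\lambda>1$ be an ordinal and let $\Omega=\langle \omega^{\omega^\lambda};\times,1,\omega,\omega+1,\omega^2+1\rangle$. For each atomic formula $E(x_1,\dots,x_p)$ of $\langle\mathbb{N};+,\times,0,1\rangle$ (i.e. a Diophantine equation), the relation $$\texttt{EQ}_E=\{((\omega+1)^{j_1},\dots,(\omega+1)^{j_p})\mid j_1,\dots,j_p\in\mathbb{N},\ \langle\mathbb{N};+,\times,0,1\rangle\models E(j_1,\dots,j_p)\}$$ is definable in $\Omega$ by a formula of the form $\exists u_1\cdots\exists u_m\,\forall v_1\cdots\forall v_6\,\varphi$ with $\varphi$ quantifier-free (for some $m$).
   Context: $\Omega$ is the structure with domain the ordinal $\omega^{\omega^\lambda}$, the ordinal multiplication $\times$ and the constants $1,\omega,\omega+1,\omega^2+1$. *)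

theory Defs
  imports Main
begin

section \<open>Ordinals\<close>

text \<open>
  The type \<open>'a ordinal\<close> consists of the ordinals below the successor cardinal of
  \<open>|'a + nat|\<close>, with their natural well-ordering. It contains the order type of every
  well-order on \<open>'a\<close> (lemma \<open>ordinal_of_Well_order\<close>) and is closed under suprema of families
  indexed by a proper initial segment (lemma \<open>ordinal_bounded\<close>), hence under the arithmetic
  operations. A statement for a variable of type \<open>'a ordinal\<close> with \<open>'a\<close> an arbitrary type
  therefore speaks about all ordinals.
\<close>

abbreviation ordinal_rel :: "('a + nat) set rel" where
  "ordinal_rel \<equiv> cardSuc (card_of (UNIV :: ('a + nat) set))"

lemma Card_order_ordinal_rel: "Card_order (ordinal_rel :: ('a + nat) set rel)"
  by (rule cardSuc_Card_order) (rule card_of_Card_order)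

lemma Well_order_ordinal_rel: "Well_order (ordinal_rel :: ('a + nat) set rel)"
  using Card_order_ordinal_rel unfolding card_order_on_def by blast

lemma infinite_Field_ordinal_rel: "infinite (Field (ordinal_rel :: ('a + nat) set rel))"
  using cardSuc_finite[OF card_of_Card_order, of "UNIV :: ('a + nat) set"]
  by (simp add: Field_card_of finite_Plus_UNIV_iff)

typedef 'a ordinal = "Field (ordinal_rel :: ('a + nat) set rel)"
  using infinite_Field_ordinal_rel infinite_imp_nonempty by blast

instantiation ordinal :: (type) wellorder
begin

definition less_eq_ordinal :: "'a ordinal \<Rightarrow> 'a ordinal \<Rightarrow> bool" where
  "\<alpha> \<le> \<beta> \<longleftrightarrow> (Rep_ordinal \<alpha>, Rep_ordinal \<beta>) \<in> ordinal_rel"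

definition less_ordinal :: "'a ordinal \<Rightarrow> 'a ordinal \<Rightarrow> bool" where
  "(\<alpha> :: 'a ordinal) < \<beta> \<longleftrightarrow> \<alpha> \<le> \<beta> \<and> \<alpha> \<noteq> \<beta>"

instance
proof
  note W = Well_order_ordinal_rel[where 'a='a, unfolded well_order_on_def linear_order_on_def
      partial_order_on_def preorder_on_def]
  fix x y z :: "'a ordinal"
  show refl: "x \<le> x"
    using W Rep_ordinal[of x] by (auto simp: less_eq_ordinal_def refl_on_def)
  show "x \<le> y \<Longrightarrow> y \<le> z \<Longrightarrow> x \<le> z"
    using W unfolding less_eq_ordinal_def trans_def by blast
  have anti: "x \<le> y \<Longrightarrow> y \<le> x \<Longrightarrow> x = y" for x y :: "'a ordinal"
    using W unfolding less_eq_ordinal_def antisym_def by (metis Rep_ordinal_inject)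
  show "x \<le> y \<Longrightarrow> y \<le> x \<Longrightarrow> x = y" by (rule anti)
  show "x < y \<longleftrightarrow> x \<le> y \<and> \<not> y \<le> x"
    using anti refl unfolding less_ordinal_def by blast
  show "x \<le> y \<or> y \<le> x"
    using W Rep_ordinal[of x] Rep_ordinal[of y] refl
    unfolding less_eq_ordinal_def total_on_def by metis
next
  fix P :: "'a ordinal \<Rightarrow> bool" and a
  assume step: "\<And>x. (\<And>y. y < x \<Longrightarrow> P y) \<Longrightarrow> P x"
  have wf: "wf (ordinal_rel - Id :: ('a + nat) set rel)"
    using Well_order_ordinal_rel unfolding well_order_on_def by blast
  have "wf (inv_image (ordinal_rel - Id) (Rep_ordinal :: 'a ordinal \<Rightarrow> _))"
    by (rule wf_inv_image[OF wf])
  then show "P a"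
  proof (induction a rule: wf_induct_rule)
    case (less x)
    show ?case
    proof (rule step)
      fix y assume "y < x"
      then have "(Rep_ordinal y, Rep_ordinal x) \<in> ordinal_rel - Id"
        unfolding less_ordinal_def less_eq_ordinal_def using Rep_ordinal_inject[of y x] by blast
      then show "P y" by (intro less) (simp only: in_inv_image)
    qed
  qed
qed

end

lemma ordinal_bounded:
  fixes f :: "'b \<Rightarrow> 'a ordinal"
  assumes "ordLeq3 (card_of I) (card_of (UNIV :: ('a + nat) set))"
  shows "\<exists>\<gamma>. \<forall>i\<in>I. f i < \<gamma>"
proof (rule ccontr)
  let ?W = "ordinal_rel :: ('a + nat) set rel"
  let ?U = "card_of (UNIV :: ('a + nat) set)"
  assume contra: "\<not> ?thesis"
  let ?g = "\<lambda>i. Rep_ordinal (f i)"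
  \<comment> \<open>no greatest element, so \<open>f ` I\<close> unbounded gives cofinality\<close>
  have nomax: "\<exists>\<beta>. \<alpha> < \<beta>" for \<alpha> :: "'a ordinal"
  proof -
    have "\<exists>b\<in>Field ?W. Rep_ordinal \<alpha> \<noteq> b \<and> (Rep_ordinal \<alpha>, b) \<in> ?W"
      using infinite_Card_order_limit[OF Card_order_ordinal_rel infinite_Field_ordinal_rel
          Rep_ordinal[of \<alpha>]] by blast
    then show ?thesis
      by (metis Abs_ordinal_inverse less_eq_ordinal_def less_ordinal_def)
  qed
  have "cofinal (?g ` I) ?W"
    unfolding cofinal_def
  proof
    fix a assume a: "a \<in> Field ?W"
    obtain \<beta> where \<beta>: "Abs_ordinal a < \<beta>" using nomax by blast
    obtain i where i: "i \<in> I" "\<not> f i < \<beta>" using contra by blast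
    then have "Abs_ordinal a < f i" using \<beta> by auto
    then show "\<exists>b\<in>?g ` I. a \<noteq> b \<and> (a, b) \<in> ?W"
      using i a unfolding less_ordinal_def less_eq_ordinal_def
      by (metis Abs_ordinal_inverse Rep_ordinal_inject image_eqI)
  qed
  moreover have "regularCard ?W"
    by (rule infinite_cardSuc_regularCard)
      (simp_all add: Field_card_of finite_Plus_UNIV_iff card_of_card_order_on)
  moreover have "?g ` I \<subseteq> Field ?W" using Rep_ordinal by blast
  ultimately have iso: "ordIso2 (card_of (?g ` I)) ?W"
    unfolding regularCard_def by blast
  have "ordLeq3 (card_of (?g ` I)) ?U"
    using card_of_image assms ordLeq_transitive by blast
  then have "ordLeq3 ?W ?U"
    using iso ordIso_ordLeq_trans ordIso_symmetric by blast
  moreover have "ordLess2 ?U ?W"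
    by (rule cardSuc_greater) (rule card_of_Card_order)
  ultimately show False
    using not_ordLess_ordLeq by blast
qed

lemma card_of_lessThan_ordinal:
  fixes \<beta> :: "'a ordinal"
  shows "ordLeq3 (card_of {..<\<beta>}) (card_of (UNIV :: ('a + nat) set))"
proof -
  let ?W = "ordinal_rel :: ('a + nat) set rel"
  have "ordLess2 (card_of (underS ?W (Rep_ordinal \<beta>))) ?W"
    by (rule card_of_underS[OF Card_order_ordinal_rel Rep_ordinal])
  then have "ordLeq3 (card_of (underS ?W (Rep_ordinal \<beta>))) (card_of (UNIV :: ('a + nat) set))"
    using cardSuc_ordLeq_ordLess[OF card_of_Card_order card_of_Card_order] by blast
  moreover have "ordLeq3 (card_of {..<\<beta>}) (card_of (underS ?W (Rep_ordinal \<beta>)))"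
    by (rule card_of_ordLeqI[where f = Rep_ordinal])
      (auto simp: inj_on_def Rep_ordinal_inject underS_def less_ordinal_def less_eq_ordinal_def)
  ultimately show ?thesis using ordLeq_transitive by blast
qed

lemma ordinal_bounded_lessThan:
  fixes f :: "'a ordinal \<Rightarrow> 'a ordinal"
  shows "\<exists>\<gamma>. \<forall>\<delta><\<beta>. f \<delta> < \<gamma>"
  using ordinal_bounded[OF card_of_lessThan_ordinal, of \<beta> f] by auto

lemma ordinal_of_Well_order:
  fixes r :: "'a rel"
  assumes r: "Well_order r"
  shows "\<exists>(\<alpha> :: 'a ordinal) f. bij_betw f (Field r) {..<\<alpha>} \<and>
           (\<forall>x\<in>Field r. \<forall>y\<in>Field r. (x, y) \<in> r \<longleftrightarrow> f x \<le> f y)"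
proof -
  let ?W = "ordinal_rel :: ('a + nat) set rel"
  let ?U = "card_of (UNIV :: ('a + nat) set)"
  have "\<not> ordLeq3 ?W r"
  proof
    assume "ordLeq3 ?W r"
    then have "ordLeq3 (card_of (Field ?W)) (card_of (Field r))"
      using card_of_mono2 by blast
    moreover have "ordLeq3 (card_of (Field r)) ?U"
      by (rule card_of_ordLeqI[where f = Inl]) auto
    ultimately have "ordLeq3 ?W ?U"
      using card_of_Field_ordIso[OF Card_order_ordinal_rel]
      by (meson ordIso_ordLeq_trans ordIso_symmetric ordLeq_transitive)
    moreover have "ordLess2 ?U ?W"
      by (rule cardSuc_greater) (rule card_of_Card_order)
    ultimately show False using not_ordLess_ordLeq by blast
  qed
  then have "ordLess2 r ?W"
    using r Well_order_ordinal_rel not_ordLeq_iff_ordLess by blast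
  then obtain a where a: "a \<in> Field ?W" and iso: "ordIso2 r (Restr ?W (underS ?W a))"
    using ordLess_iff_ordIso_Restr[OF Well_order_ordinal_rel r] by blast
  have F: "Field (Restr ?W (underS ?W a)) = underS ?W a"
    using Field_Restr_ofilter[OF Well_order_ordinal_rel wo_rel.underS_ofilter]
      Well_order_ordinal_rel unfolding wo_rel_def by blast
  obtain g where g: "iso r (Restr ?W (underS ?W a)) g"
    using iso unfolding ordIso_def by blast
  have bij: "bij_betw g (Field r) (underS ?W a)"
    using g F unfolding iso_def by simp
  have ord: "(x, y) \<in> r \<longleftrightarrow> (g x, g y) \<in> ?W" if "x \<in> Field r" "y \<in> Field r" for x y
  proof -
    have "g x \<in> underS ?W a" "g y \<in> underS ?W a"
      using bij that unfolding bij_betw_def by blast+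
    moreover have "(x, y) \<in> r \<longleftrightarrow> (g x, g y) \<in> Restr ?W (underS ?W a)"
      using g that unfolding iso_iff2 by blast
    ultimately show ?thesis by blast
  qed
  let ?f = "\<lambda>x. Abs_ordinal (g x) :: 'a ordinal"
  have gF: "g x \<in> Field ?W" if "x \<in> Field r" for x
  proof -
    have "g x \<in> underS ?W a" using bij that unfolding bij_betw_def by blast
    then have "(g x, a) \<in> ?W" unfolding underS_def by blast
    then show ?thesis by (rule FieldI1)
  qed
  have 1: "bij_betw ?f (Field r) {..<Abs_ordinal a}"
    unfolding bij_betw_def
  proof
    show "inj_on ?f (Field r)"
    proof (rule inj_onI)
      fix x y assume xy: "x \<in> Field r" "y \<in> Field r" and "?f x = ?f y"
      then have "g x = g y" using Abs_ordinal_inject[OF gF gF] by blast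
      then show "x = y" using bij xy unfolding bij_betw_def by (meson inj_onD)
    qed
    show "?f ` Field r = {..<Abs_ordinal a}"
    proof (intro equalityI subsetI)
      fix z assume "z \<in> ?f ` Field r"
      then obtain x where x: "x \<in> Field r" and z: "z = ?f x" by blast
      have "g x \<in> underS ?W a" using bij x unfolding bij_betw_def by blast
      then have "(g x, a) \<in> ?W" "g x \<noteq> a" unfolding underS_def by blast+
      then show "z \<in> {..<Abs_ordinal a}"
        unfolding z lessThan_iff less_ordinal_def less_eq_ordinal_def
        by (simp add: Abs_ordinal_inverse[OF a] Abs_ordinal_inverse[OF gF[OF x]]
            Abs_ordinal_inject[OF gF[OF x] a])
    next
      fix z :: "'a ordinal" assume "z \<in> {..<Abs_ordinal a}"
      then have "(Rep_ordinal z, a) \<in> ?W" "Rep_ordinal z \<noteq> a"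
        using Abs_ordinal_inverse[OF a] Rep_ordinal_inverse[of z]
        by (auto simp: less_ordinal_def less_eq_ordinal_def)
      then have "Rep_ordinal z \<in> underS ?W a" unfolding underS_def by blast
      then obtain x where "x \<in> Field r" "Rep_ordinal z = g x"
        using bij unfolding bij_betw_def by blast
      then show "z \<in> ?f ` Field r" by (metis Rep_ordinal_inverse image_eqI)
    qed
  qed
  have 2: "\<forall>x\<in>Field r. \<forall>y\<in>Field r. (x, y) \<in> r \<longleftrightarrow> ?f x \<le> ?f y"
  proof (intro ballI)
    fix x y assume "x \<in> Field r" "y \<in> Field r"
    then show "(x, y) \<in> r \<longleftrightarrow> ?f x \<le> ?f y"
      unfolding less_eq_ordinal_def
      by (simp only: ord Abs_ordinal_inverse[OF gF])
  qed
  show ?thesis by (intro exI conjI) (rule 1, rule 2)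
qed


section \<open>Ordinal arithmetic\<close>

instantiation ordinal :: (type) "{zero, one, plus, times}"
begin

definition zero_ordinal :: "'a ordinal" where
  "0 = (LEAST \<gamma> :: 'a ordinal. True)"

definition one_ordinal :: "'a ordinal" where
  "1 = (LEAST \<gamma> :: 'a ordinal. 0 < \<gamma>)"

text \<open>
  Each operation is the usual transfinite recursion on the second argument, with the successor
  and limit clauses merged into one least upper bound; the separate clauses are derived below.
\<close>

function plus_ordinal :: "'a ordinal \<Rightarrow> 'a ordinal \<Rightarrow> 'a ordinal" where
  "plus_ordinal \<alpha> \<beta> = (LEAST \<gamma>. \<alpha> \<le> \<gamma> \<and> (\<forall>\<delta>\<in>{..<\<beta>}. plus_ordinal \<alpha> \<delta> < \<gamma>))"
  by pat_completeness auto
termination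
  by (relation "inv_image {(x, y). x < y} snd") (simp_all add: wf)

declare plus_ordinal.simps [simp del]

function times_ordinal :: "'a ordinal \<Rightarrow> 'a ordinal \<Rightarrow> 'a ordinal" where
  "times_ordinal \<alpha> \<beta> = (LEAST \<gamma>. \<forall>\<delta>\<in>{..<\<beta>}. times_ordinal \<alpha> \<delta> + \<alpha> \<le> \<gamma>)"
  by pat_completeness auto
termination
  by (relation "inv_image {(x, y). x < y} snd") (simp_all add: wf)

instance ..

end

declare times_ordinal.simps [simp del]

function ord_exp :: "'a ordinal \<Rightarrow> 'a ordinal \<Rightarrow> 'a ordinal" where
  "ord_exp \<alpha> \<beta> =
     (if \<beta> = 0 then 1 else (LEAST \<gamma>. \<forall>\<delta>\<in>{..<\<beta>}. ord_exp \<alpha> \<delta> * \<alpha> \<le> \<gamma>))"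
  by pat_completeness auto
termination
  by (relation "inv_image {(x, y). x < y} snd") (simp_all add: wf)

declare ord_exp.simps [simp del]

definition limit_ordinal :: "'a ordinal \<Rightarrow> bool" where
  "limit_ordinal \<beta> \<longleftrightarrow> \<beta> \<noteq> 0 \<and> (\<forall>\<delta><\<beta>. \<delta> + 1 < \<beta>)"

definition ord_omega :: "'a ordinal" where
  "ord_omega = (LEAST \<beta>. limit_ordinal \<beta>)"

lemma zero_le_ordinal [simp]: "(0 :: 'a ordinal) \<le> \<alpha>"
  unfolding zero_ordinal_def by (simp add: Least_le)

lemma not_less_zero_ordinal [simp]: "\<not> \<alpha> < (0 :: 'a ordinal)"
  by (simp add: not_less)

lemma less_plus_ordinal_iff:
  fixes \<alpha> :: "'a ordinal"
  shows "x < \<alpha> + \<beta> \<longleftrightarrow> x < \<alpha> \<or> (\<exists>\<delta><\<beta>. x \<le> \<alpha> + \<delta>)"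
proof -
  let ?P = "\<lambda>\<gamma>. \<alpha> \<le> \<gamma> \<and> (\<forall>\<delta>\<in>{..<\<beta>}. \<alpha> + \<delta> < \<gamma>)"
  obtain \<gamma> where \<gamma>: "\<forall>\<delta><\<beta>. \<alpha> + \<delta> < \<gamma>"
    using ordinal_bounded_lessThan[of \<beta> "\<lambda>\<delta>. \<alpha> + \<delta>"] by blast
  have "\<forall>\<delta><\<beta>. \<alpha> + \<delta> < max \<alpha> \<gamma>"
    using \<gamma> by (simp add: less_max_iff_disj)
  then have "?P (max \<alpha> \<gamma>)" by auto
  then have P: "?P (Least ?P)" by (rule LeastI)
  have eq: "\<alpha> + \<beta> = Least ?P" by (rule plus_ordinal.simps)
  show ?thesis
  proof
    assume "x < \<alpha> + \<beta>"
    then have "\<not> ?P x" using eq not_less_Least[of x ?P] by simp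
    then show "x < \<alpha> \<or> (\<exists>\<delta><\<beta>. x \<le> \<alpha> + \<delta>)" by auto
  next
    assume "x < \<alpha> \<or> (\<exists>\<delta><\<beta>. x \<le> \<alpha> + \<delta>)"
    moreover have "?P (\<alpha> + \<beta>)" using P unfolding eq .
    ultimately show "x < \<alpha> + \<beta>" by (meson le_less_trans lessThan_iff less_le_trans)
  qed
qed

lemma less_times_ordinal_iff:
  fixes \<alpha> :: "'a ordinal"
  shows "x < \<alpha> * \<beta> \<longleftrightarrow> (\<exists>\<delta><\<beta>. x < \<alpha> * \<delta> + \<alpha>)"
proof -
  let ?P = "\<lambda>\<gamma>. \<forall>\<delta>\<in>{..<\<beta>}. \<alpha> * \<delta> + \<alpha> \<le> \<gamma>"
  obtain \<gamma> where "\<forall>\<delta><\<beta>. \<alpha> * \<delta> + \<alpha> < \<gamma>"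
    using ordinal_bounded_lessThan[of \<beta> "\<lambda>\<delta>. \<alpha> * \<delta> + \<alpha>"] by blast
  then have "?P \<gamma>" by (auto intro: less_imp_le)
  then have P: "?P (Least ?P)" by (rule LeastI)
  have eq: "\<alpha> * \<beta> = Least ?P" by (rule times_ordinal.simps)
  show ?thesis
  proof
    assume "x < \<alpha> * \<beta>"
    then have "\<not> ?P x" using eq not_less_Least[of x ?P] by simp
    then show "\<exists>\<delta><\<beta>. x < \<alpha> * \<delta> + \<alpha>" by auto
  next
    assume "\<exists>\<delta><\<beta>. x < \<alpha> * \<delta> + \<alpha>"
    then show "x < \<alpha> * \<beta>" using P eq by (auto intro: less_le_trans)
  qed
qed

lemma less_ord_exp_iff:
  fixes \<alpha> :: "'a ordinal"
  assumes "\<beta> \<noteq> 0"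
  shows "x < ord_exp \<alpha> \<beta> \<longleftrightarrow> (\<exists>\<delta><\<beta>. x < ord_exp \<alpha> \<delta> * \<alpha>)"
proof -
  let ?P = "\<lambda>\<gamma>. \<forall>\<delta>\<in>{..<\<beta>}. ord_exp \<alpha> \<delta> * \<alpha> \<le> \<gamma>"
  obtain \<gamma> where "\<forall>\<delta><\<beta>. ord_exp \<alpha> \<delta> * \<alpha> < \<gamma>"
    using ordinal_bounded_lessThan[of \<beta> "\<lambda>\<delta>. ord_exp \<alpha> \<delta> * \<alpha>"] by blast
  then have "?P \<gamma>" by (auto intro: less_imp_le)
  then have P: "?P (Least ?P)" by (rule LeastI)
  have eq: "ord_exp \<alpha> \<beta> = Least ?P" using assms by (simp add: ord_exp.simps[of \<alpha> \<beta>])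
  show ?thesis
  proof
    assume "x < ord_exp \<alpha> \<beta>"
    then have "\<not> ?P x" using eq not_less_Least[of x ?P] by simp
    then show "\<exists>\<delta><\<beta>. x < ord_exp \<alpha> \<delta> * \<alpha>" by auto
  next
    assume "\<exists>\<delta><\<beta>. x < ord_exp \<alpha> \<delta> * \<alpha>"
    then show "x < ord_exp \<alpha> \<beta>" using P eq by (auto intro: less_le_trans)
  qed
qed

lemma ordinal_eqI:
  fixes \<alpha> :: "'a ordinal"
  assumes "\<And>x. x < \<alpha> \<longleftrightarrow> x < \<beta>"
  shows "\<alpha> = \<beta>"
  using assms by (metis less_irrefl linorder_neqE)

lemma zero_less_one_ordinal [simp]: "(0 :: 'a ordinal) < 1"
proof -
  obtain \<gamma> :: "'a ordinal" where "\<forall>i\<in>{()}. 0 < \<gamma>"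
    using ordinal_bounded[of "{()}" "\<lambda>_. 0 :: 'a ordinal"]
    by (metis UNIV_I card_of_singl_ordLeq empty_iff ordLeq_transitive)
  then show ?thesis unfolding one_ordinal_def by (auto intro: LeastI)
qed

lemma less_one_ordinal_iff [simp]: "\<alpha> < (1 :: 'a ordinal) \<longleftrightarrow> \<alpha> = 0"
proof
  show "\<alpha> < 1 \<Longrightarrow> \<alpha> = 0"
    unfolding one_ordinal_def using not_less_Least zero_le_ordinal by (metis order_le_less)
qed simp

lemma ordinal_add_zero: "\<alpha> + 0 = (\<alpha> :: 'a ordinal)"
  by (rule ordinal_eqI) (simp add: less_plus_ordinal_iff)

lemma less_add_one_ordinal_iff: "x < \<alpha> + 1 \<longleftrightarrow> x \<le> (\<alpha> :: 'a ordinal)"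
  by (auto simp: less_plus_ordinal_iff ordinal_add_zero)

lemma ordinal_add_strict_mono: "\<beta> < \<gamma> \<Longrightarrow> \<alpha> + \<beta> < \<alpha> + (\<gamma> :: 'a ordinal)"
  using less_plus_ordinal_iff by blast

lemma ordinal_add_mono: "\<beta> \<le> \<gamma> \<Longrightarrow> \<alpha> + \<beta> \<le> \<alpha> + (\<gamma> :: 'a ordinal)"
  using ordinal_add_strict_mono by (metis order_le_less)

lemma ordinal_le_add: "\<alpha> \<le> \<alpha> + (\<beta> :: 'a ordinal)"
  using ordinal_add_mono[of 0 \<beta> \<alpha>] by (simp add: ordinal_add_zero)

lemma ordinal_add_assoc: "\<alpha> + \<beta> + \<gamma> = \<alpha> + (\<beta> + \<gamma> :: 'a ordinal)"
proof (induction \<gamma> rule: less_induct)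
  case (less \<gamma>)
  show ?case
  proof (rule ordinal_eqI)
    fix x
    have "x < \<alpha> + (\<beta> + \<gamma>) \<longleftrightarrow> x < \<alpha> \<or> (\<exists>\<delta><\<beta>. x \<le> \<alpha> + \<delta>) \<or> (\<exists>\<delta><\<gamma>. x \<le> \<alpha> + (\<beta> + \<delta>))"
    proof
      assume "x < \<alpha> + (\<beta> + \<gamma>)"
      then consider "x < \<alpha>" | \<delta> where "\<delta> < \<beta> + \<gamma>" "x \<le> \<alpha> + \<delta>"
        unfolding less_plus_ordinal_iff[of x \<alpha> "\<beta> + \<gamma>"] by blast
      then show "x < \<alpha> \<or> (\<exists>\<delta><\<beta>. x \<le> \<alpha> + \<delta>) \<or> (\<exists>\<delta><\<gamma>. x \<le> \<alpha> + (\<beta> + \<delta>))"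
      proof cases
        case 2
        then show ?thesis
          using less_plus_ordinal_iff[of \<delta> \<beta> \<gamma>] ordinal_add_mono[of \<delta> _ \<alpha>] order_trans by blast
      qed blast
    next
      assume "x < \<alpha> \<or> (\<exists>\<delta><\<beta>. x \<le> \<alpha> + \<delta>) \<or> (\<exists>\<delta><\<gamma>. x \<le> \<alpha> + (\<beta> + \<delta>))"
      then show "x < \<alpha> + (\<beta> + \<gamma>)"
        unfolding less_plus_ordinal_iff[of x \<alpha> "\<beta> + \<gamma>"]
        using less_plus_ordinal_iff[of _ \<beta> \<gamma>] by blast
    qed
    moreover have "x < \<alpha> + \<beta> + \<gamma> \<longleftrightarrow> x < \<alpha> + \<beta> \<or> (\<exists>\<delta><\<gamma>. x \<le> \<alpha> + (\<beta> + \<delta>))"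
      using less.IH by (auto simp: less_plus_ordinal_iff[of x "\<alpha> + \<beta>" \<gamma>])
    ultimately show "x < \<alpha> + \<beta> + \<gamma> \<longleftrightarrow> x < \<alpha> + (\<beta> + \<gamma>)"
      using less_plus_ordinal_iff[of x \<alpha> \<beta>] by blast
  qed
qed

lemma ordinal_add_succ: "\<alpha> + (\<beta> + 1) = (\<alpha> + \<beta>) + (1 :: 'a ordinal)"
  by (simp add: ordinal_add_assoc)

lemma ordinal_add_limit:
  assumes "limit_ordinal \<beta>"
  shows "\<alpha> + \<beta> = (LEAST \<gamma>. \<forall>\<delta><\<beta>. \<alpha> + \<delta> \<le> \<gamma>)"
proof (rule Least_equality[symmetric])
  show "\<forall>\<delta><\<beta>. \<alpha> + \<delta> \<le> \<alpha> + \<beta>" using ordinal_add_mono less_imp_le by blast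
next
  fix y assume y: "\<forall>\<delta><\<beta>. \<alpha> + \<delta> \<le> y"
  show "\<alpha> + \<beta> \<le> y"
  proof (rule ccontr)
    assume "\<not> \<alpha> + \<beta> \<le> y"
    then have "y < \<alpha> + \<beta>" by simp
    moreover have "0 < \<beta>" using assms unfolding limit_ordinal_def by (simp add: order_less_le)
    moreover have "\<alpha> \<le> y" using y \<open>0 < \<beta>\<close> by (metis ordinal_add_zero)
    ultimately obtain \<delta> where \<delta>: "\<delta> < \<beta>" "y \<le> \<alpha> + \<delta>"
      using less_plus_ordinal_iff[of y \<alpha> \<beta>] by auto
    then have "\<delta> + 1 < \<beta>" using assms unfolding limit_ordinal_def by blast
    then have "\<alpha> + (\<delta> + 1) \<le> y" using y by blast
    then show False
      using \<delta> ordinal_add_strict_mono[of \<delta> "\<delta> + 1" \<alpha>] less_add_one_ordinal_iff[of \<delta> \<delta>] by simp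
  qed
qed

lemma ordinal_times_zero: "\<alpha> * 0 = (0 :: 'a ordinal)"
  by (rule ordinal_eqI) (simp add: less_times_ordinal_iff)

lemma ordinal_times_mono: "\<beta> \<le> \<gamma> \<Longrightarrow> \<alpha> * \<beta> \<le> \<alpha> * (\<gamma> :: 'a ordinal)"
  using less_times_ordinal_iff by (metis leD leI less_le_trans order_refl)

lemma ordinal_zero_add: "0 + \<alpha> = (\<alpha> :: 'a ordinal)"
proof (induction \<alpha> rule: less_induct)
  case (less \<alpha>)
  then show ?case
    by (intro ordinal_eqI) (auto simp: less_plus_ordinal_iff intro: le_less_trans)
qed

lemma ordinal_add_right_mono: "\<alpha> \<le> \<beta> \<Longrightarrow> \<alpha> + \<gamma> \<le> \<beta> + (\<gamma> :: 'a ordinal)"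
proof (induction \<gamma> rule: less_induct)
  case (less \<gamma>)
  show ?case
  proof (rule ccontr)
    assume "\<not> ?case"
    then have "\<beta> + \<gamma> < \<alpha> + \<gamma>" by simp
    then consider "\<beta> + \<gamma> < \<alpha>" | \<delta> where "\<delta> < \<gamma>" "\<beta> + \<gamma> \<le> \<alpha> + \<delta>"
      using less_plus_ordinal_iff[of "\<beta> + \<gamma>" \<alpha> \<gamma>] by blast
    then show False
    proof cases
      case 1
      then show ?thesis using less.prems ordinal_le_add[of \<beta> \<gamma>] by simp
    next
      case 2
      then have "\<beta> + \<gamma> \<le> \<beta> + \<delta>" using less by (meson order_trans)
      then show ?thesis using ordinal_add_strict_mono[OF 2(1), of \<beta>] by simp
    qed
  qed
qed

lemma ordinal_times_succ: "\<alpha> * (\<beta> + 1) = \<alpha> * \<beta> + (\<alpha> :: 'a ordinal)"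
proof (rule ordinal_eqI)
  fix x
  show "x < \<alpha> * (\<beta> + 1) \<longleftrightarrow> x < \<alpha> * \<beta> + \<alpha>"
    unfolding less_times_ordinal_iff[of x \<alpha> "\<beta> + 1"] less_add_one_ordinal_iff
    using ordinal_add_right_mono[OF ordinal_times_mono] by (meson less_le_trans order_refl)
qed

lemma ordinal_times_limit:
  assumes "limit_ordinal \<beta>"
  shows "\<alpha> * \<beta> = (LEAST \<gamma>. \<forall>\<delta><\<beta>. \<alpha> * \<delta> \<le> \<gamma>)"
proof (rule Least_equality[symmetric])
  show "\<forall>\<delta><\<beta>. \<alpha> * \<delta> \<le> \<alpha> * \<beta>" using ordinal_times_mono less_imp_le by blast
next
  fix y assume y: "\<forall>\<delta><\<beta>. \<alpha> * \<delta> \<le> y"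
  show "\<alpha> * \<beta> \<le> y"
  proof (rule ccontr)
    assume "\<not> \<alpha> * \<beta> \<le> y"
    then obtain \<delta> where \<delta>: "\<delta> < \<beta>" "y < \<alpha> * \<delta> + \<alpha>"
      using less_times_ordinal_iff[of y \<alpha> \<beta>] by auto
    then have "\<delta> + 1 < \<beta>" using assms unfolding limit_ordinal_def by blast
    then show False using y \<delta> ordinal_times_succ by (metis leD)
  qed
qed

lemma ordinal_times_one: "\<alpha> * 1 = (\<alpha> :: 'a ordinal)"
  using ordinal_times_succ[of \<alpha> 0] by (simp add: ordinal_zero_add ordinal_times_zero)

lemma ordinal_one_times: "1 * \<alpha> = (\<alpha> :: 'a ordinal)"
proof (induction \<alpha> rule: less_induct)
  case (less \<alpha>)
  then show ?case
    by (intro ordinal_eqI)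
      (auto simp: less_times_ordinal_iff less_add_one_ordinal_iff intro: le_less_trans)
qed

lemma ordinal_distrib_left: "\<alpha> * (\<beta> + \<gamma>) = \<alpha> * \<beta> + \<alpha> * (\<gamma> :: 'a ordinal)"
proof (induction \<gamma> rule: less_induct)
  case (less \<gamma>)
  show ?case
  proof (cases "\<gamma> = 0")
    case True
    then show ?thesis by (simp add: ordinal_add_zero ordinal_times_zero)
  next
    case False
    then have pos: "0 < \<gamma>" by (simp add: order_less_le)
    show ?thesis
    proof (rule ordinal_eqI)
      fix x
      show "x < \<alpha> * (\<beta> + \<gamma>) \<longleftrightarrow> x < \<alpha> * \<beta> + \<alpha> * \<gamma>"
      proof
        assume "x < \<alpha> * (\<beta> + \<gamma>)"
        then obtain \<epsilon> where \<epsilon>: "\<epsilon> < \<beta> + \<gamma>" "x < \<alpha> * \<epsilon> + \<alpha>"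
          using less_times_ordinal_iff by blast
        obtain \<delta> where \<delta>: "\<delta> < \<gamma>" "\<epsilon> \<le> \<beta> + \<delta>"
          using \<epsilon>(1) pos unfolding less_plus_ordinal_iff[of \<epsilon> \<beta> \<gamma>]
          by (metis less_imp_le ordinal_add_zero)
        have "x < \<alpha> * (\<beta> + \<delta>) + \<alpha>"
          using \<epsilon>(2) ordinal_add_right_mono[OF ordinal_times_mono[OF \<delta>(2)]] less_le_trans by blast
        also have "\<dots> = \<alpha> * \<beta> + \<alpha> * (\<delta> + 1)"
          using less.IH[OF \<delta>(1)] by (simp add: ordinal_times_succ ordinal_add_assoc)
        also have "\<dots> \<le> \<alpha> * \<beta> + \<alpha> * \<gamma>"
          using \<delta>(1) by (intro ordinal_add_mono ordinal_times_mono)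
            (metis less_add_one_ordinal_iff not_le)
        finally show "x < \<alpha> * \<beta> + \<alpha> * \<gamma>" .
      next
        assume "x < \<alpha> * \<beta> + \<alpha> * \<gamma>"
        then consider "x < \<alpha> * \<beta>" | \<epsilon> where "\<epsilon> < \<alpha> * \<gamma>" "x \<le> \<alpha> * \<beta> + \<epsilon>"
          using less_plus_ordinal_iff by blast
        then show "x < \<alpha> * (\<beta> + \<gamma>)"
        proof cases
          case 1
          then show ?thesis
            using ordinal_times_mono[OF ordinal_le_add] less_le_trans by blast
        next
          case 2
          then obtain \<delta> where \<delta>: "\<delta> < \<gamma>" "\<epsilon> < \<alpha> * \<delta> + \<alpha>"
            using less_times_ordinal_iff by blast
          have "x < \<alpha> * \<beta> + (\<alpha> * \<delta> + \<alpha>)"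
            using 2(2) ordinal_add_strict_mono[OF \<delta>(2)] le_less_trans by blast
          also have "\<dots> = \<alpha> * (\<beta> + \<delta>) + \<alpha>"
            using less.IH[OF \<delta>(1)] by (simp add: ordinal_add_assoc)
          finally show ?thesis
            using ordinal_add_strict_mono[OF \<delta>(1), of \<beta>] less_times_ordinal_iff by blast
        qed
      qed
    qed
  qed
qed

lemma ordinal_times_assoc: "\<alpha> * \<beta> * \<gamma> = \<alpha> * (\<beta> * \<gamma> :: 'a ordinal)"
proof (induction \<gamma> rule: less_induct)
  case (less \<gamma>)
  have step: "\<alpha> * \<beta> * \<delta> + \<alpha> * \<beta> = \<alpha> * (\<beta> * \<delta> + \<beta>)" if "\<delta> < \<gamma>" for \<delta>
    using less[OF that] by (simp add: ordinal_distrib_left)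
  show ?case
  proof (rule ordinal_eqI)
    fix x
    have "x < \<alpha> * (\<beta> * \<gamma>) \<longleftrightarrow> (\<exists>\<delta><\<gamma>. x < \<alpha> * (\<beta> * \<delta> + \<beta>))"
      unfolding less_times_ordinal_iff[of x \<alpha>] less_times_ordinal_iff[of _ \<beta> \<gamma>] by blast
    then show "x < \<alpha> * \<beta> * \<gamma> \<longleftrightarrow> x < \<alpha> * (\<beta> * \<gamma>)"
      unfolding less_times_ordinal_iff[of x "\<alpha> * \<beta>" \<gamma>] using step by auto
  qed
qed

instance ordinal :: (type) monoid_add
  by standard (rule ordinal_add_assoc ordinal_zero_add ordinal_add_zero)+

instance ordinal :: (type) monoid_mult
  by standard (rule ordinal_times_assoc ordinal_one_times ordinal_times_one)+

lemma ordinal_times_right_mono: "\<alpha> \<le> \<beta> \<Longrightarrow> \<alpha> * \<gamma> \<le> \<beta> * (\<gamma> :: 'a ordinal)"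
proof (induction \<gamma> rule: less_induct)
  case (less \<gamma>)
  have "x < \<beta> * \<gamma>" if x: "x < \<alpha> * \<gamma>" for x
  proof -
    obtain \<delta> where \<delta>: "\<delta> < \<gamma>" "x < \<alpha> * \<delta> + \<alpha>"
      using x less_times_ordinal_iff by blast
    have "\<alpha> * \<delta> + \<alpha> \<le> \<beta> * \<delta> + \<beta>"
      using ordinal_add_right_mono[OF less.IH[OF \<delta>(1) less.prems], of \<alpha>]
        ordinal_add_mono[OF less.prems, of "\<beta> * \<delta>"] by (rule order_trans)
    then show ?thesis using \<delta> less_times_ordinal_iff less_le_trans by blast
  qed
  then show ?case by (meson leI less_irrefl)
qed

lemma ord_exp_zero: "ord_exp \<alpha> 0 = 1"
  by (simp add: ord_exp.simps)

lemma ord_exp_pos: "0 < \<alpha> \<Longrightarrow> 0 < ord_exp \<alpha> \<beta>"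
proof (cases "\<beta> = 0")
  case False
  assume "0 < \<alpha>"
  moreover have "0 < \<beta>" using False by (simp add: order_less_le)
  ultimately show ?thesis
    using less_ord_exp_iff[OF False, of 0 \<alpha>] by (metis mult_1_left ord_exp_zero)
qed (simp add: ord_exp_zero)

lemma ord_exp_mono:
  assumes "0 < \<alpha>" "\<beta> \<le> \<gamma>"
  shows "ord_exp \<alpha> \<beta> \<le> ord_exp \<alpha> \<gamma>"
proof (cases "\<beta> = 0")
  case True
  then show ?thesis
    using ord_exp_pos[OF assms(1), of \<gamma>] by (metis leI less_one_ordinal_iff order_less_irrefl ord_exp_zero)
next
  case False
  then have "\<gamma> \<noteq> 0" using assms(2) by (metis not_less_zero_ordinal order_le_less)
  then have "x < ord_exp \<alpha> \<gamma>" if "x < ord_exp \<alpha> \<beta>" for x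
    using that False assms(2) less_ord_exp_iff less_le_trans by metis
  then show ?thesis by (meson leI less_irrefl)
qed

lemma ord_exp_succ:
  assumes "0 < \<alpha>"
  shows "ord_exp \<alpha> (\<beta> + 1) = ord_exp \<alpha> \<beta> * \<alpha>"
proof (rule ordinal_eqI)
  fix x
  have "\<beta> + 1 \<noteq> 0" using less_add_one_ordinal_iff[of \<beta> \<beta>] by auto
  then show "x < ord_exp \<alpha> (\<beta> + 1) \<longleftrightarrow> x < ord_exp \<alpha> \<beta> * \<alpha>"
    unfolding less_ord_exp_iff[OF \<open>\<beta> + 1 \<noteq> 0\<close>] less_add_one_ordinal_iff
    using ordinal_times_right_mono[OF ord_exp_mono[OF assms]] by (meson less_le_trans order_refl)
qed

lemma ord_exp_limit:
  assumes "0 < \<alpha>" "limit_ordinal \<beta>"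
  shows "ord_exp \<alpha> \<beta> = (LEAST \<gamma>. \<forall>\<delta><\<beta>. ord_exp \<alpha> \<delta> \<le> \<gamma>)"
proof (rule Least_equality[symmetric])
  show "\<forall>\<delta><\<beta>. ord_exp \<alpha> \<delta> \<le> ord_exp \<alpha> \<beta>"
    using ord_exp_mono[OF assms(1)] less_imp_le by blast
next
  fix y assume y: "\<forall>\<delta><\<beta>. ord_exp \<alpha> \<delta> \<le> y"
  show "ord_exp \<alpha> \<beta> \<le> y"
  proof (rule ccontr)
    assume "\<not> ord_exp \<alpha> \<beta> \<le> y"
    then obtain \<delta> where \<delta>: "\<delta> < \<beta>" "y < ord_exp \<alpha> \<delta> * \<alpha>"
      using less_ord_exp_iff[of \<beta> y \<alpha>] assms(2) unfolding limit_ordinal_def by auto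
    then have "\<delta> + 1 < \<beta>" using assms(2) unfolding limit_ordinal_def by blast
    then show False using y \<delta> ord_exp_succ[OF assms(1)] by (metis leD)
  qed
qed

lemma limit_ordinal_omega: "limit_ordinal (ord_omega :: 'a ordinal)"
proof -
  define f :: "nat \<Rightarrow> 'a ordinal" where "f = rec_nat 0 (\<lambda>_ \<alpha>. \<alpha> + 1)"
  have fS: "f (Suc n) = f n + 1" for n by (simp add: f_def)
  have "ordLeq3 (card_of (UNIV :: nat set)) (card_of (UNIV :: ('a + nat) set))"
    by (rule card_of_ordLeqI[where f = Inr]) auto
  then obtain \<gamma> where \<gamma>: "\<forall>n. f n < \<gamma>" using ordinal_bounded[of UNIV f] by auto
  define \<beta> where "\<beta> = (LEAST \<gamma>. \<forall>n. f n < \<gamma>)"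
  have \<beta>: "f n < \<beta>" for n
    using LeastI[of "\<lambda>\<gamma>. \<forall>n. f n < \<gamma>", OF \<gamma>] unfolding \<beta>_def by blast
  have "\<delta> + 1 < \<beta>" if \<delta>: "\<delta> < \<beta>" for \<delta>
  proof -
    obtain n where "\<delta> \<le> f n"
      using not_less_Least[OF \<delta>[unfolded \<beta>_def]] by (meson not_less)
    then have "\<delta> + 1 \<le> f (Suc n)" unfolding fS by (rule ordinal_add_right_mono)
    then show ?thesis using \<beta>[of "Suc n"] by (rule le_less_trans)
  qed
  moreover have "\<beta> \<noteq> 0" using \<beta>[of 0] by auto
  ultimately have "limit_ordinal \<beta>" unfolding limit_ordinal_def by blast
  then show ?thesis unfolding ord_omega_def by (rule LeastI)
qed


section \<open>First-order logic over constants and binary operations\<close>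

datatype ('c, 'b) trm =
    Var nat
  | Const 'c
  | Bin 'b "('c, 'b) trm" "('c, 'b) trm"

datatype ('c, 'b) fm =
    Eq "('c, 'b) trm" "('c, 'b) trm"
  | Neg "('c, 'b) fm"
  | Conj "('c, 'b) fm" "('c, 'b) fm"
  | Disj "('c, 'b) fm" "('c, 'b) fm"
  | Ex nat "('c, 'b) fm"
  | All nat "('c, 'b) fm"

record ('c, 'b, 'd) fo_structure =
  domain :: "'d set"
  const_of :: "'c \<Rightarrow> 'd"
  bin_of :: "'b \<Rightarrow> 'd \<Rightarrow> 'd \<Rightarrow> 'd"

primrec val :: "('c, 'b, 'd) fo_structure \<Rightarrow> (nat \<Rightarrow> 'd) \<Rightarrow> ('c, 'b) trm \<Rightarrow> 'd" where
  "val M e (Var i) = e i"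
| "val M e (Const c) = const_of M c"
| "val M e (Bin b s t) = bin_of M b (val M e s) (val M e t)"

primrec sat :: "('c, 'b, 'd) fo_structure \<Rightarrow> (nat \<Rightarrow> 'd) \<Rightarrow> ('c, 'b) fm \<Rightarrow> bool" where
  "sat M e (Eq s t) \<longleftrightarrow> val M e s = val M e t"
| "sat M e (Neg \<phi>) \<longleftrightarrow> \<not> sat M e \<phi>"
| "sat M e (Conj \<phi> \<psi>) \<longleftrightarrow> sat M e \<phi> \<and> sat M e \<psi>"
| "sat M e (Disj \<phi> \<psi>) \<longleftrightarrow> sat M e \<phi> \<or> sat M e \<psi>"
| "sat M e (Ex i \<phi>) \<longleftrightarrow> (\<exists>a\<in>domain M. sat M (e(i := a)) \<phi>)"
| "sat M e (All i \<phi>) \<longleftrightarrow> (\<forall>a\<in>domain M. sat M (e(i := a)) \<phi>)"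

primrec trm_vars :: "('c, 'b) trm \<Rightarrow> nat set" where
  "trm_vars (Var i) = {i}"
| "trm_vars (Const c) = {}"
| "trm_vars (Bin b s t) = trm_vars s \<union> trm_vars t"

primrec free_vars :: "('c, 'b) fm \<Rightarrow> nat set" where
  "free_vars (Eq s t) = trm_vars s \<union> trm_vars t"
| "free_vars (Neg \<phi>) = free_vars \<phi>"
| "free_vars (Conj \<phi> \<psi>) = free_vars \<phi> \<union> free_vars \<psi>"
| "free_vars (Disj \<phi> \<psi>) = free_vars \<phi> \<union> free_vars \<psi>"
| "free_vars (Ex i \<phi>) = free_vars \<phi> - {i}"
| "free_vars (All i \<phi>) = free_vars \<phi> - {i}"

primrec quantifier_free :: "('c, 'b) fm \<Rightarrow> bool" where
  "quantifier_free (Eq s t) \<longleftrightarrow> True"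
| "quantifier_free (Neg \<phi>) \<longleftrightarrow> quantifier_free \<phi>"
| "quantifier_free (Conj \<phi> \<psi>) \<longleftrightarrow> quantifier_free \<phi> \<and> quantifier_free \<psi>"
| "quantifier_free (Disj \<phi> \<psi>) \<longleftrightarrow> quantifier_free \<phi> \<and> quantifier_free \<psi>"
| "quantifier_free (Ex i \<phi>) \<longleftrightarrow> False"
| "quantifier_free (All i \<phi>) \<longleftrightarrow> False"

definition atomic_fm :: "('c, 'b) fm \<Rightarrow> bool" where
  "atomic_fm \<phi> \<longleftrightarrow> (\<exists>s t. \<phi> = Eq s t)"

definition exists_forall_form :: "nat \<Rightarrow> nat \<Rightarrow> ('c, 'b) fm \<Rightarrow> bool" where
  "exists_forall_form m k \<Phi> \<longleftrightarrow>
     (\<exists>us vs \<phi>. length us = m \<and> length vs = k \<and> distinct (us @ vs) \<and> quantifier_free \<phi> \<and>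
        \<Phi> = foldr Ex us (foldr All vs \<phi>))"

text \<open>
  The free variables \<open>x\<^sub>1, \<dots>, x\<^sub>p\<close> are \<open>Var 0, \<dots>, Var (p - 1)\<close>, and
  \<open>p\<close>-tuples are lists of length \<open>p\<close>. The value \<open>xs ! i\<close> for \<open>i \<ge> p\<close> is irrelevant because
  such variables do not occur free.
\<close>

definition defines_relation ::
  "('c, 'b, 'd) fo_structure \<Rightarrow> nat \<Rightarrow> ('c, 'b) fm \<Rightarrow> 'd list set \<Rightarrow> bool" where
  "defines_relation M p \<Phi> R \<longleftrightarrow>
     free_vars \<Phi> \<subseteq> {..<p} \<and>
     R = {xs. length xs = p \<and> set xs \<subseteq> domain M \<and> sat M ((!) xs) \<Phi>}"


section \<open>The two structures\<close>

datatype nat_const = NZero | NOne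
datatype nat_op = NPlus | NTimes

definition nat_structure :: "(nat_const, nat_op, nat) fo_structure" where
  "nat_structure =
     \<lparr>domain = UNIV,
      const_of = (\<lambda>c. case c of NZero \<Rightarrow> 0 | NOne \<Rightarrow> 1),
      bin_of = (\<lambda>b. case b of NPlus \<Rightarrow> (+) | NTimes \<Rightarrow> (*))\<rparr>"

datatype omega_const = C_one | C_omega | C_omega_plus_one | C_omega_sq_plus_one
datatype omega_op = O_times

definition omega_structure ::
  "'a ordinal \<Rightarrow> (omega_const, omega_op, 'a ordinal) fo_structure" where
  "omega_structure l =
     \<lparr>domain = {\<alpha>. \<alpha> < ord_exp ord_omega (ord_exp ord_omega l)},
      const_of = (\<lambda>c. case c of
          C_one \<Rightarrow> 1
        | C_omega \<Rightarrow> ord_omega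
        | C_omega_plus_one \<Rightarrow> ord_omega + 1
        | C_omega_sq_plus_one \<Rightarrow> ord_omega ^ 2 + 1),
      bin_of = (\<lambda>b. case b of O_times \<Rightarrow> (*))\<rparr>"

definition EQ_rel :: "nat \<Rightarrow> (nat_const, nat_op) fm \<Rightarrow> 'a ordinal list set" where
  "EQ_rel p E =
     {map (\<lambda>j. (ord_omega + 1) ^ j) js | js :: nat list.
        length js = p \<and> sat nat_structure ((!) js) E}"

end

theory Submission
  imports Defs
begin

text \<open>
  The number \<open>k\<close> is represented by \<open>\<omega>\<^sup>k\<close>; these ordinals are exactly the nonzero ones commuting with
  \<open>\<omega>\<close>, and multiplying them adds exponents. The ordinal \<open>(\<omega> + 1)\<^sup>k\<close> is the only \<open>\<xi>\<close> that commutes with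
  \<open>\<omega> + 1\<close> and satisfies \<open>\<xi> \<omega> = \<omega>\<^sup>k \<omega>\<close>, so it only remains to define multiplication of exponents.

  For \<open>n \<ge> 1\<close> the ordinal \<open>\<sigma> = \<omega>\<^sup>n + 1\<close> is the only multiplicatively irreducible \<open>\<sigma> \<noteq> \<omega>\<close> with
  \<open>\<sigma> \<omega> = \<omega>\<^sup>n \<omega>\<close>, and the ordinals of finite degree commuting with it are its powers. Hence \<open>n\<close>
  divides \<open>m\<close> iff some \<open>\<xi>\<close> with \<open>\<xi> \<omega> = \<omega>\<^sup>m \<omega>\<close> commutes with \<open>\<sigma>\<close>, and least common multiples of exponents
  are definable, with two universal quantifiers for irreducibility and four for minimality. Products
  come from \<open>lcm (n + 1) (n + 2) = (n + 1) (n + 2)\<close> by polarization.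

  Universal quantifiers distribute over conjunctions, so all these conditions share the same
  universally quantified variables. Four of them suffice; the other two are dummies.
\<close>

notation ord_omega ("\<omega>")
notation omega_structure ("\<Omega>")


section \<open>Ordinal arithmetic\<close>

lemma ordinal_pos_iff [simp]: "0 < \<alpha> \<longleftrightarrow> \<alpha> \<noteq> (0 :: 'a ordinal)"
  by (auto simp: order_less_le)

lemma ordinal_one_le_iff: "1 \<le> \<alpha> \<longleftrightarrow> \<alpha> \<noteq> (0 :: 'a ordinal)"
  using less_one_ordinal_iff[of \<alpha>] by (metis leD leI)

instance ordinal :: (type) zero_neq_one
  by standard (metis order_less_irrefl zero_less_one_ordinal)

instance ordinal :: (type) mult_zero
proof
  fix \<alpha> :: "'a ordinal"
  show "\<alpha> * 0 = 0" by (rule ordinal_times_zero)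
  show "0 * \<alpha> = 0"
  proof (induction \<alpha> rule: less_induct)
    case (less \<alpha>)
    then show ?case using less_times_ordinal_iff[of 0 0 \<alpha>] by auto
  qed
qed

lemma ordinal_times_strict_mono:
  assumes "\<alpha> \<noteq> 0" "\<beta> < \<gamma>"
  shows "\<alpha> * \<beta> < \<alpha> * (\<gamma> :: 'a ordinal)"
  unfolding less_times_ordinal_iff[of _ \<alpha> \<gamma>]
  using assms ordinal_add_strict_mono[of 0 \<alpha> "\<alpha> * \<beta>"] by auto

lemma ordinal_times_left_cancel:
  assumes "\<alpha> * \<beta> = \<alpha> * \<gamma>" "\<alpha> \<noteq> (0 :: 'a ordinal)"
  shows "\<beta> = \<gamma>"
  using assms ordinal_times_strict_mono[of \<alpha>] by (metis linorder_neqE order_less_irrefl)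

lemma ordinal_add_left_cancel: "\<alpha> + \<beta> = \<alpha> + \<gamma> \<longleftrightarrow> \<beta> = (\<gamma> :: 'a ordinal)"
  using ordinal_add_strict_mono[of _ _ \<alpha>] by (metis linorder_neqE order_less_irrefl)

lemma ordinal_times_eq_zero_iff [simp]: "\<alpha> * \<beta> = 0 \<longleftrightarrow> \<alpha> = 0 \<or> \<beta> = (0 :: 'a ordinal)"
  by (metis mult_zero_left mult_zero_right ordinal_times_left_cancel)

lemma ordinal_power_eq_zero_iff [simp]: "\<alpha> ^ n = 0 \<longleftrightarrow> \<alpha> = (0 :: 'a ordinal) \<and> n \<noteq> 0"
  by (induction n) auto

lemma ordinal_le_add_left: "\<beta> \<le> \<alpha> + (\<beta> :: 'a ordinal)"
  using ordinal_add_right_mono[of 0 \<alpha> \<beta>] by simp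

lemma ordinal_le_times_right: "\<beta> \<noteq> 0 \<Longrightarrow> \<alpha> \<le> \<alpha> * (\<beta> :: 'a ordinal)"
  using ordinal_times_mono[of 1 \<beta> \<alpha>] by (simp add: ordinal_one_le_iff)

lemma ordinal_le_times_left: "\<alpha> \<noteq> 0 \<Longrightarrow> \<beta> \<le> \<alpha> * (\<beta> :: 'a ordinal)"
  using ordinal_times_right_mono[of 1 \<alpha> \<beta>] by (simp add: ordinal_one_le_iff)

lemma ordinal_add_one_le_iff: "\<alpha> + 1 \<le> \<beta> \<longleftrightarrow> \<alpha> < (\<beta> :: 'a ordinal)"
  using less_add_one_ordinal_iff[of \<beta> \<alpha>] by (metis leD leI)

lemma ordinal_less_add_one [simp]: "\<alpha> < \<alpha> + (1 :: 'a ordinal)"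
  by (simp add: less_add_one_ordinal_iff)

lemma ordinal_add_one_inject [simp]: "\<alpha> + 1 = \<beta> + 1 \<longleftrightarrow> \<alpha> = (\<beta> :: 'a ordinal)"
  by (metis less_add_one_ordinal_iff order_antisym order_refl)

lemma ordinal_add_one_eq_one_iff [simp]: "\<alpha> + 1 = 1 \<longleftrightarrow> \<alpha> = (0 :: 'a ordinal)"
  using ordinal_add_one_inject[of \<alpha> 0] by simp

lemma ordinal_add_one_neq_zero [simp]: "\<alpha> + 1 \<noteq> (0 :: 'a ordinal)"
  using ordinal_less_add_one[of \<alpha>] by (metis not_less_zero_ordinal)

lemma ordinal_subtraction:
  assumes "\<alpha> \<le> (\<beta> :: 'a ordinal)"
  obtains \<delta> where "\<beta> = \<alpha> + \<delta>"
proof -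
  define \<delta> where "\<delta> = (LEAST \<delta>. \<beta> \<le> \<alpha> + \<delta>)"
  have "\<beta> \<le> \<alpha> + \<delta>" unfolding \<delta>_def by (rule LeastI) (rule ordinal_le_add_left)
  moreover have "\<not> \<beta> < \<alpha> + \<delta>"
    using assms not_less_Least[of _ "\<lambda>\<delta>. \<beta> \<le> \<alpha> + \<delta>"]
    unfolding less_plus_ordinal_iff \<delta>_def[symmetric] by auto
  ultimately show ?thesis using that by (meson leI order_antisym)
qed

lemma ordinal_division:
  assumes "\<alpha> \<noteq> (0 :: 'a ordinal)"
  obtains \<beta> \<gamma> where "\<xi> = \<alpha> * \<beta> + \<gamma>" "\<gamma> < \<alpha>"
proof -
  define \<beta> where "\<beta> = (LEAST \<beta>. \<xi> < \<alpha> * \<beta> + \<alpha>)"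
  have "\<xi> < \<alpha> * (\<xi> + 1)"
    using ordinal_le_times_left[OF assms] less_add_one_ordinal_iff less_le_trans by blast
  then have upper: "\<xi> < \<alpha> * \<beta> + \<alpha>" unfolding \<beta>_def ordinal_times_succ by (rule LeastI)
  have "\<not> \<xi> < \<alpha> * \<beta>"
    using not_less_Least[of _ "\<lambda>\<beta>. \<xi> < \<alpha> * \<beta> + \<alpha>"]
    unfolding less_times_ordinal_iff \<beta>_def[symmetric] by auto
  then obtain \<gamma> where \<gamma>: "\<xi> = \<alpha> * \<beta> + \<gamma>" using ordinal_subtraction by (meson leI)
  have "\<gamma> < \<alpha>" using upper unfolding \<gamma> by (meson leI leD ordinal_add_mono)
  then show ?thesis using \<gamma> that by blast
qed

lemma ordinal_division_unique:
  assumes "\<alpha> * \<beta> + \<gamma> = \<alpha> * \<beta>' + \<gamma>'" "\<gamma> < \<alpha>" "\<gamma>' < (\<alpha> :: 'a ordinal)"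
  shows "\<beta> = \<beta>' \<and> \<gamma> = \<gamma>'"
proof -
  have less: "\<alpha> * \<beta> + \<gamma> < \<alpha> * \<beta>' + \<gamma>'" if "\<beta> < \<beta>'" "\<gamma> < \<alpha>" for \<beta> \<beta>' \<gamma> \<gamma>' :: "'a ordinal"
  proof -
    have "\<alpha> * \<beta> + \<gamma> < \<alpha> * \<beta>'"
      using that ordinal_add_strict_mono less_times_ordinal_iff by blast
    then show ?thesis using ordinal_le_add less_le_trans by blast
  qed
  have "\<beta> = \<beta>'"
    using assms less by (metis linorder_neqE order_less_irrefl)
  then show ?thesis using assms(1) by (simp add: ordinal_add_left_cancel)
qed

lemma ordinal_power_strict_mono:
  assumes "1 < (\<alpha> :: 'a ordinal)" "m < n"
  shows "\<alpha> ^ m < \<alpha> ^ n"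
proof -
  have "\<alpha> \<noteq> 0" using assms(1) by auto
  then have step: "\<alpha> ^ k < \<alpha> ^ Suc k" for k
    using assms(1) ordinal_times_strict_mono[of "\<alpha> ^ k" 1 \<alpha>] by (simp add: power_commutes)
  show ?thesis by (rule lift_Suc_mono_less[of "(^) \<alpha>", OF step assms(2)])
qed

lemma ordinal_power_inject: "1 < (\<alpha> :: 'a ordinal) \<Longrightarrow> \<alpha> ^ m = \<alpha> ^ n \<longleftrightarrow> m = n"
  by (metis linorder_neqE_nat order_less_irrefl ordinal_power_strict_mono)

lemma ordinal_power_less_iff: "1 < (\<alpha> :: 'a ordinal) \<Longrightarrow> \<alpha> ^ m < \<alpha> ^ n \<longleftrightarrow> m < n"
  by (metis linorder_neqE_nat order_less_asym order_less_irrefl ordinal_power_strict_mono)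


section \<open>Limit ordinals\<close>

lemma limit_ordinal_neq_zero: "limit_ordinal \<alpha> \<Longrightarrow> \<alpha> \<noteq> 0"
  by (simp add: limit_ordinal_def)

lemma limit_ordinal_add_one_less:
  assumes "limit_ordinal \<beta>" "\<alpha> < \<beta>"
  shows "\<alpha> + 1 < \<beta>"
  using assms(1)[unfolded limit_ordinal_def] assms(2) by blast

lemma not_limit_ordinal_add_one: "\<not> limit_ordinal (\<alpha> + 1)"
  using ordinal_less_add_one limit_ordinal_add_one_less by (metis order_less_irrefl)

lemma ordinal_cases [case_names zero succ limit]:
  obtains "\<alpha> = 0" | \<beta> where "\<alpha> = \<beta> + 1" | "limit_ordinal \<alpha>"
proof -
  have "\<alpha> = \<beta> + 1" if "\<beta> < \<alpha>" "\<not> \<beta> + 1 < \<alpha>" for \<beta>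
    using that ordinal_add_one_le_iff[of \<beta> \<alpha>] by (simp add: order_less_le)
  then show ?thesis using that unfolding limit_ordinal_def by blast
qed

lemma limit_ordinal_times_right:
  assumes "\<alpha> \<noteq> 0" "limit_ordinal \<beta>"
  shows "limit_ordinal (\<alpha> * \<beta>)"
proof -
  have "\<xi> + 1 < \<alpha> * \<beta>" if \<xi>: "\<xi> < \<alpha> * \<beta>" for \<xi>
  proof -
    obtain \<delta> where \<delta>: "\<delta> < \<beta>" "\<xi> < \<alpha> * (\<delta> + 1)"
      using \<xi> unfolding less_times_ordinal_iff[of \<xi>] ordinal_times_succ by blast
    have "\<xi> + 1 \<le> \<alpha> * (\<delta> + 1)" using \<delta>(2) by (simp add: ordinal_add_one_le_iff)
    also have "\<dots> < \<alpha> * \<beta>"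
      using \<delta>(1) assms by (intro ordinal_times_strict_mono limit_ordinal_add_one_less)
    finally show ?thesis .
  qed
  then show ?thesis using assms by (simp add: limit_ordinal_def)
qed

lemma limit_ordinal_add:
  assumes "limit_ordinal \<beta>"
  shows "limit_ordinal (\<alpha> + \<beta>)"
proof -
  have "\<xi> + 1 < \<alpha> + \<beta>" if "\<xi> < \<alpha> + \<beta>" for \<xi>
  proof -
    have "\<exists>\<delta><\<beta>. \<xi> \<le> \<alpha> + \<delta>"
      using that assms unfolding less_plus_ordinal_iff limit_ordinal_def
      by (metis add_0_right less_imp_le ordinal_pos_iff)
    then obtain \<delta> where \<delta>: "\<delta> < \<beta>" "\<xi> \<le> \<alpha> + \<delta>" by blast
    have "\<xi> + 1 \<le> \<alpha> + (\<delta> + 1)"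
      using ordinal_add_right_mono[OF \<delta>(2)] by (simp add: add.assoc)
    also have "\<dots> < \<alpha> + \<beta>"
      using \<delta>(1) assms by (intro ordinal_add_strict_mono limit_ordinal_add_one_less)
    finally show ?thesis .
  qed
  moreover have "\<alpha> + \<beta> \<noteq> 0"
    using ordinal_le_add_left[of \<beta> \<alpha>] limit_ordinal_neq_zero[OF assms]
    by (metis not_less_zero_ordinal order_le_less)
  ultimately show ?thesis by (simp add: limit_ordinal_def)
qed

lemma limit_ordinal_times_left:
  assumes "limit_ordinal \<alpha>" "\<beta> \<noteq> 0"
  shows "limit_ordinal (\<alpha> * \<beta>)"
proof -
  have "\<xi> + 1 < \<alpha> * \<beta>" if "\<xi> < \<alpha> * \<beta>" for \<xi>
    using that limit_ordinal_add[OF assms(1)] unfolding less_times_ordinal_iff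
    by (blast intro: limit_ordinal_add_one_less)
  then show ?thesis using assms by (simp add: limit_ordinal_def)
qed

lemma successor_times_successor:
  assumes "\<alpha> * \<beta> = \<gamma> + (1 :: 'a ordinal)"
  obtains \<alpha>' \<beta>' where "\<alpha> = \<alpha>' + 1" "\<beta> = \<beta>' + 1"
proof -
  have nonzero: "\<alpha> \<noteq> 0" "\<beta> \<noteq> 0"
    using assms by (metis mult_zero_left mult_zero_right ordinal_add_one_neq_zero)+
  have "\<not> limit_ordinal (\<alpha> * \<beta>)" unfolding assms by (rule not_limit_ordinal_add_one)
  then have "\<not> limit_ordinal \<alpha>" "\<not> limit_ordinal \<beta>"
    using nonzero limit_ordinal_times_left limit_ordinal_times_right by blast+
  then show ?thesis using nonzero that ordinal_cases[of \<alpha>] ordinal_cases[of \<beta>] by metis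
qed


section \<open>Finite ordinals and \<open>\<omega>\<close>\<close>

lemma omega_neq_zero [simp]: "\<omega> \<noteq> 0"
  using limit_ordinal_omega by (rule limit_ordinal_neq_zero)

lemma add_one_less_omega: "n < \<omega> \<Longrightarrow> n + 1 < \<omega>"
  using limit_ordinal_omega by (rule limit_ordinal_add_one_less)

lemma one_less_omega [simp]: "1 < \<omega>"
  using add_one_less_omega[of 0] by simp

lemma omega_neq_one [simp]: "\<omega> \<noteq> 1"
  using one_less_omega by (metis order_less_irrefl)

lemma less_omega_cases:
  assumes "n < \<omega>"
  obtains "n = 0" | m where "m < n" "m < \<omega>" "n = m + 1"
proof (cases n rule: ordinal_cases)
  case (succ m)
  then have "m < n" by simp
  then show ?thesis using that(2)[of m] assms succ by (meson order_less_trans)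
next
  case limit
  then show ?thesis using assms not_less_Least unfolding ord_omega_def by blast
qed (use that in blast)

lemma less_omega_induct [consumes 1, case_names zero succ]:
  assumes "n < \<omega>" "P 0" "\<And>n. n < \<omega> \<Longrightarrow> P n \<Longrightarrow> P (n + 1)"
  shows "P n"
  using assms(1)
proof (induction n rule: less_induct)
  case (less n)
  from less.prems show ?case by (cases rule: less_omega_cases) (use less.IH assms(2,3) in auto)
qed

lemma add_less_omega: "n < \<omega> \<Longrightarrow> m < \<omega> \<Longrightarrow> m + n < \<omega>"
  by (induction n rule: less_omega_induct) (auto simp: add.assoc[symmetric] intro: add_one_less_omega)

lemma times_less_omega: "n < \<omega> \<Longrightarrow> m < \<omega> \<Longrightarrow> m * n < \<omega>"
  by (induction n rule: less_omega_induct) (auto simp: ordinal_times_succ intro: add_less_omega)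

lemma finite_times_omega:
  assumes "n < \<omega>" "n \<noteq> 0"
  shows "n * \<omega> = \<omega>"
proof (rule order_antisym)
  show "n * \<omega> \<le> \<omega>"
  proof (rule leI, rule notI)
    assume "\<omega> < n * \<omega>"
    then obtain m where "m < \<omega>" "\<omega> < n * m + n" using less_times_ordinal_iff by blast
    then show False using add_less_omega times_less_omega assms(1) by (metis order_less_asym)
  qed
qed (rule ordinal_le_times_left[OF assms(2)])

lemma finite_add_omega:
  assumes "n < \<omega>"
  shows "n + \<omega> = \<omega>"
proof (rule order_antisym)
  show "n + \<omega> \<le> \<omega>"
  proof (rule leI, rule notI)
    assume "\<omega> < n + \<omega>"
    then obtain m where "m < \<omega>" "\<omega> \<le> n + m"
      using assms less_plus_ordinal_iff[of \<omega> n \<omega>] by (metis order_less_asym)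
    then show False using add_less_omega[of m n] assms by simp
  qed
qed (rule ordinal_le_add_left)

lemma finite_add_omega_times:
  assumes "n < \<omega>" "\<alpha> \<noteq> 0"
  shows "n + \<omega> * \<alpha> = \<omega> * \<alpha>"
proof -
  obtain \<delta> where "\<alpha> = 1 + \<delta>"
    using ordinal_subtraction[of 1 \<alpha>] assms(2) by (auto simp: ordinal_one_le_iff)
  then show ?thesis
    using finite_add_omega[OF assms(1)] by (simp add: ordinal_distrib_left add.assoc[symmetric])
qed

lemma add_times_omega:
  assumes "\<beta> \<le> \<alpha>"
  shows "(\<alpha> + \<beta>) * \<omega> = \<alpha> * (\<omega> :: 'a ordinal)"
proof (rule order_antisym)
  have "\<alpha> + \<beta> \<le> \<alpha> * (1 + 1)"
    using ordinal_add_mono[OF assms, of \<alpha>] by (simp add: ordinal_distrib_left)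
  then have "(\<alpha> + \<beta>) * \<omega> \<le> \<alpha> * ((1 + 1) * \<omega>)"
    using ordinal_times_right_mono by (metis mult.assoc)
  then show "(\<alpha> + \<beta>) * \<omega> \<le> \<alpha> * \<omega>"
    using finite_times_omega[of "1 + 1 :: 'a ordinal"] by (simp add: add_one_less_omega)
qed (rule ordinal_times_right_mono[OF ordinal_le_add])

lemma less_times_omega: "\<alpha> \<noteq> 0 \<Longrightarrow> \<alpha> < \<alpha> * \<omega>"
  using ordinal_times_strict_mono[of \<alpha> 1 \<omega>] by simp

lemma times_omega_eq_self_iff [simp]: "\<alpha> * \<omega> = \<alpha> \<longleftrightarrow> \<alpha> = 0"
  using less_times_omega by (metis mult_zero_left order_less_irrefl)

lemma add_less_times_omega:
  assumes "\<beta> < \<alpha> * \<omega>" "\<gamma> < \<alpha> * \<omega>"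
  shows "\<beta> + \<gamma> < \<alpha> * \<omega>"
proof -
  have "\<alpha> \<noteq> 0" using assms(1) by auto
  obtain i j where i: "i < \<omega>" "\<beta> < \<alpha> * (i + 1)" and j: "j < \<omega>" "\<gamma> < \<alpha> * (j + 1)"
    using assms unfolding less_times_ordinal_iff[of _ \<alpha> \<omega>] ordinal_times_succ by blast
  have "\<beta> + \<gamma> \<le> \<alpha> * (i + 1) + \<gamma>" using i(2) by (intro ordinal_add_right_mono less_imp_le)
  also have "\<dots> < \<alpha> * (i + 1) + \<alpha> * (j + 1)" using j(2) by (rule ordinal_add_strict_mono)
  also have "\<dots> = \<alpha> * ((i + 1) + (j + 1))" by (simp only: ordinal_distrib_left)
  also have "\<dots> < \<alpha> * \<omega>"
    using i j \<open>\<alpha> \<noteq> 0\<close> by (intro ordinal_times_strict_mono add_less_omega add_one_less_omega)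
  finally show ?thesis .
qed

lemma omega_times_cases [case_names multiple succ]:
  obtains \<eta> where "\<xi> = \<omega> * \<eta>" | \<eta> where "\<xi> = \<eta> + 1"
proof -
  obtain \<eta> n where \<eta>: "\<xi> = \<omega> * \<eta> + n" "n < \<omega>" using ordinal_division[OF omega_neq_zero] by blast
  from \<eta>(2) show ?thesis
    by (cases rule: less_omega_cases) (use \<eta>(1) that in \<open>auto simp: add.assoc[symmetric]\<close>)
qed


section \<open>Degrees\<close>

lemma omega_power_inject [simp]: "\<omega> ^ m = \<omega> ^ n \<longleftrightarrow> m = n"
  by (rule ordinal_power_inject[OF one_less_omega])

lemma omega_power_eq_one_iff [simp]: "\<omega> ^ n = 1 \<longleftrightarrow> n = 0"
  using omega_power_inject[of n 0] by simp

lemma omega_power_times_omega: "\<omega> ^ n * \<omega> = \<omega> ^ (n + 1)"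
  by (simp add: power_commutes)

text \<open>Equivalently, the Cantor normal form of \<open>\<xi>\<close> has leading exponent \<open>n\<close>.\<close>
definition has_degree :: "'a ordinal \<Rightarrow> nat \<Rightarrow> bool" where
  "has_degree \<xi> n \<longleftrightarrow> \<xi> * \<omega> = \<omega> ^ Suc n"

lemma has_degree_neq_zero: "has_degree \<xi> n \<Longrightarrow> \<xi> \<noteq> 0"
  by (auto simp: has_degree_def)

lemma has_degree_unique: "has_degree \<xi> m \<Longrightarrow> has_degree \<xi> n \<Longrightarrow> m = n"
  unfolding has_degree_def by (metis Suc_inject one_less_omega ordinal_power_inject)

lemma has_degree_mono:
  assumes "\<xi> \<le> \<eta>" "has_degree \<xi> m" "has_degree \<eta> n"
  shows "m \<le> n"
proof -
  have "\<omega> ^ Suc m \<le> (\<omega> ^ Suc n :: 'a ordinal)"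
    using ordinal_times_right_mono[OF assms(1), of \<omega>] assms(2,3) unfolding has_degree_def by simp
  then show ?thesis
    using ordinal_power_less_iff[OF one_less_omega, of "Suc n" "Suc m"] by (metis Suc_less_eq leD leI)
qed

lemma has_degree_omega_power: "has_degree (\<omega> ^ n) n"
  by (simp add: has_degree_def power_commutes)

lemma has_degree_omega_power_add_one: "has_degree (\<omega> ^ n + 1) n"
  by (simp add: has_degree_def add_times_omega ordinal_one_le_iff power_commutes)

lemma has_degree_times_omega_power_Suc:
  "has_degree \<xi> m \<Longrightarrow> \<xi> * \<omega> ^ Suc n = \<omega> ^ Suc (m + n)"
  unfolding has_degree_def by (metis add_Suc mult.assoc power_Suc power_add)

lemma has_degree_times_omega_power:
  "has_degree \<xi> m \<Longrightarrow> n > 0 \<Longrightarrow> \<xi> * \<omega> ^ n = \<omega> ^ (m + n)"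
  using has_degree_times_omega_power_Suc[of \<xi> m "n - 1"] by simp

lemma has_degree_times:
  assumes "has_degree \<xi> m" "has_degree \<eta> n"
  shows "has_degree (\<xi> * \<eta>) (m + n)"
  using has_degree_times_omega_power_Suc[OF assms(1), of n] assms(2)
  by (simp add: has_degree_def mult.assoc)

lemma has_degree_power: "has_degree \<xi> n \<Longrightarrow> has_degree (\<xi> ^ j) (n * j)"
proof (induction j)
  case 0
  show ?case using has_degree_omega_power[of 0] by simp
next
  case (Suc j)
  then show ?case using has_degree_times[of \<xi> n "\<xi> ^ j" "n * j"] by simp
qed

lemma has_degree_zero_imp_finite: "has_degree \<xi> 0 \<Longrightarrow> \<xi> < \<omega>"
  using less_times_omega[OF has_degree_neq_zero] by (fastforce simp: has_degree_def)

lemma finite_imp_has_degree_zero: "n < \<omega> \<Longrightarrow> n \<noteq> 0 \<Longrightarrow> has_degree n 0"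
  by (simp add: has_degree_def finite_times_omega)

lemma has_degree_cofactor:
  assumes "has_degree \<sigma> n" "has_degree (\<sigma> * \<beta>) m"
  shows "n \<le> m \<and> has_degree \<beta> (m - n)"
proof
  have "\<beta> \<noteq> 0" using has_degree_neq_zero[OF assms(2)] by simp
  then show "n \<le> m" using has_degree_mono[OF _ assms] ordinal_le_times_right by blast
  then have "\<sigma> * (\<beta> * \<omega>) = \<sigma> * \<omega> ^ Suc (m - n)"
    using assms(2) has_degree_times_omega_power_Suc[OF assms(1), of "m - n"]
    by (simp add: has_degree_def mult.assoc)
  then show "has_degree \<beta> (m - n)"
    unfolding has_degree_def using has_degree_neq_zero[OF assms(1)]
    by (rule ordinal_times_left_cancel)
qed

lemma omega_power_times_eq_omega_power_iff:
  "\<omega> ^ i * \<delta> = \<omega> ^ k \<longleftrightarrow> i \<le> k \<and> \<delta> = \<omega> ^ (k - i)"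
proof
  assume eq: "\<omega> ^ i * \<delta> = \<omega> ^ k"
  have "i \<le> k"
    using has_degree_cofactor[OF has_degree_omega_power, of i \<delta>] has_degree_omega_power[of k]
    unfolding eq by blast
  moreover from this have "\<omega> ^ i * \<delta> = \<omega> ^ i * \<omega> ^ (k - i)"
    using eq by (simp add: power_add[symmetric])
  ultimately show "i \<le> k \<and> \<delta> = \<omega> ^ (k - i)" using ordinal_times_left_cancel by fastforce
qed (simp add: power_add[symmetric])


section \<open>Centralizers of \<open>\<omega>\<close> and \<open>\<omega>\<^sup>n + 1\<close>\<close>

lemma commutes_omega_iff: "\<xi> * \<omega> = \<omega> * \<xi> \<longleftrightarrow> \<xi> = 0 \<or> (\<exists>k. \<xi> = \<omega> ^ k)"
proof
  assume "\<xi> * \<omega> = \<omega> * \<xi>"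
  then show "\<xi> = 0 \<or> (\<exists>k. \<xi> = \<omega> ^ k)"
  proof (induction \<xi> rule: less_induct)
    case (less \<xi>)
    obtain \<beta> n where \<beta>: "\<xi> = \<omega> * \<beta> + n" "n < \<omega>"
      using ordinal_division[OF omega_neq_zero] by blast
    show ?case
    proof (cases "\<beta> = 0")
      case True
      then have "\<xi> = 0 \<or> \<omega> * \<xi> = \<omega> * \<omega> ^ 0"
        using \<beta> less.prems finite_times_omega[of \<xi>]
        by (metis add_0_left mult_zero_right power_0 mult_1_right)
      then show ?thesis using ordinal_times_left_cancel omega_neq_zero by blast
    next
      case False
      have "n \<le> \<omega> * \<beta>"
        using ordinal_le_times_right[OF False] \<beta>(2) by (meson less_imp_le less_le_trans)
      then have "\<omega> * (\<beta> * \<omega>) = \<omega> * \<xi>"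
        using less.prems unfolding \<beta>(1) by (simp add: add_times_omega mult.assoc)
      then have "\<beta> * \<omega> = \<xi>" by (rule ordinal_times_left_cancel) simp
      then have "limit_ordinal (\<omega> * \<beta> + n)"
        using limit_ordinal_times_right[OF False limit_ordinal_omega] \<beta>(1) by simp
      then have "n \<noteq> m + 1" for m
        using not_limit_ordinal_add_one[of "\<omega> * \<beta> + m"] by (auto simp: add.assoc[symmetric])
      then have "n = 0" using less_omega_cases[OF \<beta>(2)] by blast
      then have comm: "\<beta> * \<omega> = \<omega> * \<beta>" using \<open>\<beta> * \<omega> = \<xi>\<close> \<beta>(1) by simp
      moreover have "\<beta> < \<xi>" using less_times_omega[OF False] \<open>\<beta> * \<omega> = \<xi>\<close> by simp
      ultimately obtain k where "\<beta> = \<omega> ^ k" using less.IH False by blast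
      then have "\<xi> = \<omega> ^ Suc k" using \<open>\<beta> * \<omega> = \<xi>\<close> by (simp add: power_commutes)
      then show ?thesis by blast
    qed
  qed
qed (auto simp: power_commutes)

text \<open>
  With \<open>\<xi> = (\<omega>\<^sup>n + 1) \<beta> + \<gamma>\<close>, both sides of the commutation have explicit divisions by \<open>\<omega>\<^sup>n + 1\<close>, with
  remainders \<open>0\<close> and \<open>\<gamma>\<close>.
\<close>
lemma commuting_factor:
  assumes comm: "\<xi> * (\<omega> ^ n + 1) = (\<omega> ^ n + 1) * \<xi>"
    and deg: "has_degree \<xi> m" and "m > 0" "n > 0"
  obtains \<beta> where "\<xi> = (\<omega> ^ n + 1) * \<beta>" "\<beta> * (\<omega> ^ n + 1) = (\<omega> ^ n + 1) * \<beta>"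
proof -
  let ?s = "\<omega> ^ n + 1"
  obtain \<beta> \<gamma> where \<beta>: "\<xi> = ?s * \<beta> + \<gamma>" "\<gamma> < ?s"
    using ordinal_division[of ?s] ordinal_add_one_neq_zero by metis
  have "\<xi> * \<omega> ^ n = \<omega> ^ (n + m)"
    using has_degree_times_omega_power[OF deg \<open>n > 0\<close>] by (simp add: add.commute)
  also have "\<dots> = ?s * \<omega> ^ m"
    using \<open>m > 0\<close>
    by (intro has_degree_times_omega_power[symmetric] has_degree_omega_power_add_one)
  finally have "\<xi> * \<omega> ^ n = ?s * \<omega> ^ m" .
  then have "?s * \<xi> = ?s * \<omega> ^ m + \<xi>"
    unfolding comm[symmetric] ordinal_distrib_left by simp
  also have "\<dots> = ?s * (\<omega> ^ m + \<beta>) + \<gamma>"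
    unfolding \<beta>(1) by (simp add: ordinal_distrib_left add.assoc)
  finally have "\<gamma> = 0"
    using ordinal_division_unique[of ?s \<xi> 0 "\<omega> ^ m + \<beta>" \<gamma>] \<beta>(2) by simp
  then have factor: "\<xi> = ?s * \<beta>" using \<beta>(1) by simp
  have "?s * (\<beta> * ?s) = ?s * (?s * \<beta>)" using comm unfolding factor by (simp add: mult.assoc)
  then have "\<beta> * ?s = ?s * \<beta>" by (rule ordinal_times_left_cancel) simp
  then show ?thesis using factor that by blast
qed

lemma omega_power_add_one_times_succ:
  fixes \<gamma> :: "'a ordinal"
  assumes "n > 0"
  shows "(\<omega> ^ n + 1) * (\<gamma> + 1) = \<omega> ^ n * (\<gamma> + 1) + 1"
proof -
  obtain \<eta> m where \<eta>: "\<gamma> = \<omega> * \<eta> + m" "m < \<omega>"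
    using ordinal_division[OF omega_neq_zero] by blast
  have absorb: "1 + \<omega> ^ n = (\<omega> ^ n :: 'a ordinal)"
    using assms finite_add_omega_times[of 1 "\<omega> ^ (n - 1) :: 'a ordinal"] by (cases n) simp_all
  have finite_case: "(\<omega> ^ n + 1) * (m + 1) = \<omega> ^ n * (m + 1) + 1"
    using \<eta>(2)
  proof (induction m rule: less_omega_induct)
    case (succ k)
    then show ?case
      unfolding ordinal_times_succ[of _ "k + 1"]
      by (simp add: add.assoc) (simp add: add.assoc[symmetric] absorb)
  qed simp
  have "(\<omega> ^ n + 1) * (\<omega> * \<eta>) = \<omega> ^ n * (\<omega> * \<eta>)"
    by (simp add: mult.assoc[symmetric] add_times_omega ordinal_one_le_iff)
  then show ?thesis
    using finite_case unfolding \<eta>(1) add.assoc ordinal_distrib_left[of _ "\<omega> * \<eta>"]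
    by (simp add: add.assoc)
qed

text \<open>Compare \<open>\<xi> (\<omega>\<^sup>n + 1) = \<omega>\<^sup>n + \<xi>\<close> with \<open>(\<omega>\<^sup>n + 1) \<xi> = \<omega>\<^sup>n \<xi> + 1\<close>.\<close>
lemma finite_commutes_omega_power_add_one:
  assumes "\<xi> * (\<omega> ^ n + 1) = (\<omega> ^ n + 1) * \<xi>" "n > 0" "\<xi> < \<omega>" "\<xi> \<noteq> 0"
  shows "\<xi> = 1"
proof -
  obtain k where k: "\<xi> = k + 1" using assms(3,4) by (cases rule: less_omega_cases) auto
  have "has_degree \<xi> 0" using assms(3,4) by (rule finite_imp_has_degree_zero)
  then have "\<xi> * \<omega> ^ n = \<omega> ^ n" using has_degree_times_omega_power[of \<xi> 0 n] \<open>n > 0\<close> by simp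
  then have "\<omega> ^ n * 1 + \<xi> = \<omega> ^ n * \<xi> + 1"
    using assms(1) omega_power_add_one_times_succ[OF \<open>n > 0\<close>, of k]
    by (simp add: k ordinal_distrib_left)
  moreover have "\<omega> \<le> \<omega> ^ n" using \<open>n > 0\<close> by (cases n) (simp_all add: ordinal_le_times_right)
  then have "\<xi> < \<omega> ^ n" "1 < \<omega> ^ n"
    using assms(3) one_less_omega by (meson less_le_trans)+
  ultimately show ?thesis using ordinal_division_unique by blast
qed

lemma commutes_omega_power_add_one_iff:
  assumes "has_degree \<xi> m" "n > 0"
  shows "\<xi> * (\<omega> ^ n + 1) = (\<omega> ^ n + 1) * \<xi> \<longleftrightarrow> (\<exists>j. \<xi> = (\<omega> ^ n + 1) ^ j)"
proof
  assume "\<xi> * (\<omega> ^ n + 1) = (\<omega> ^ n + 1) * \<xi>"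
  then show "\<exists>j. \<xi> = (\<omega> ^ n + 1) ^ j"
    using assms(1)
  proof (induction m arbitrary: \<xi> rule: less_induct)
    case (less m)
    show ?case
    proof (cases "m = 0")
      case True
      then have "\<xi> = 1"
        using less.prems assms(2)
        by (intro finite_commutes_omega_power_add_one has_degree_zero_imp_finite
            has_degree_neq_zero) auto
      then show ?thesis by (metis power_0)
    next
      case False
      then obtain \<beta> where \<beta>: "\<xi> = (\<omega> ^ n + 1) * \<beta>" "\<beta> * (\<omega> ^ n + 1) = (\<omega> ^ n + 1) * \<beta>"
        using commuting_factor[OF less.prems _ assms(2)] by blast
      then have "has_degree \<beta> (m - n)"
        using has_degree_cofactor[OF has_degree_omega_power_add_one, of n \<beta> m] less.prems(2) by blast
      moreover have "m - n < m" using False assms(2) by simp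
      ultimately obtain j where "\<beta> = (\<omega> ^ n + 1) ^ j" using less.IH[OF _ \<beta>(2)] by blast
      then show ?thesis using \<beta>(1) by (metis power_Suc)
    qed
  qed
qed (auto simp: power_commutes)

lemma dvd_iff_commutes:
  assumes "n > 0"
  shows "n dvd m \<longleftrightarrow> (\<exists>\<xi> :: 'a ordinal. \<xi> * (\<omega> ^ n + 1) = (\<omega> ^ n + 1) * \<xi> \<and> has_degree \<xi> m)"
proof
  assume "n dvd m"
  then obtain j where "m = n * j" by blast
  then have "has_degree ((\<omega> ^ n + 1 :: 'a ordinal) ^ j) m"
    using has_degree_power[OF has_degree_omega_power_add_one] by blast
  then show "\<exists>\<xi> :: 'a ordinal. \<xi> * (\<omega> ^ n + 1) = (\<omega> ^ n + 1) * \<xi> \<and> has_degree \<xi> m"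
    using power_commutes by blast
next
  assume "\<exists>\<xi> :: 'a ordinal. \<xi> * (\<omega> ^ n + 1) = (\<omega> ^ n + 1) * \<xi> \<and> has_degree \<xi> m"
  then obtain j where "has_degree ((\<omega> ^ n + 1 :: 'a ordinal) ^ j) m"
    using commutes_omega_power_add_one_iff[OF _ assms] by blast
  then have "m = n * j"
    using has_degree_power[OF has_degree_omega_power_add_one] has_degree_unique by blast
  then show "n dvd m" by simp
qed

lemma eq_power_omega_add_one_iff:
  "\<xi> = (\<omega> + 1) ^ j \<longleftrightarrow> \<xi> * (\<omega> + 1) = (\<omega> + 1) * \<xi> \<and> has_degree \<xi> j"
proof -
  have deg: "has_degree ((\<omega> + 1 :: 'a ordinal) ^ i) i" for i
    using has_degree_power[OF has_degree_omega_power_add_one, of 1 i] by simp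
  show ?thesis
    using commutes_omega_power_add_one_iff[of \<xi> j 1] deg has_degree_unique
    by (auto simp: power_commutes)
qed


section \<open>The irreducible ordinals \<open>\<omega>\<^sup>n + 1\<close>\<close>

definition irreducible_in :: "'a :: monoid_mult set \<Rightarrow> 'a \<Rightarrow> bool" where
  "irreducible_in D c \<longleftrightarrow> (\<forall>a\<in>D. \<forall>b\<in>D. a * b = c \<longrightarrow> a = 1 \<or> b = 1)"

lemma irreducible_in_lessThan:
  assumes "\<sigma> \<noteq> 0" "\<sigma> < (\<gamma> :: 'a ordinal)"
  shows "irreducible_in {..<\<gamma>} \<sigma> \<longleftrightarrow> irreducible_in UNIV \<sigma>"
proof -
  have "\<alpha> < \<gamma> \<and> \<beta> < \<gamma>" if "\<alpha> * \<beta> = \<sigma>" for \<alpha> \<beta>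
    using that assms ordinal_le_times_left[of \<alpha> \<beta>] ordinal_le_times_right[of \<beta> \<alpha>] by auto
  then show ?thesis unfolding irreducible_in_def by blast
qed

lemma less_omega_power_factor:
  assumes "\<beta> < \<omega> ^ n" "\<beta> \<noteq> 0"
  shows "\<exists>k \<gamma>. \<beta> = \<omega> ^ k * (\<gamma> + 1)"
  using assms
proof (induction n arbitrary: \<beta>)
  case (Suc n)
  show ?case
  proof (cases \<beta> rule: omega_times_cases)
    case (multiple \<delta>)
    then have "\<delta> < \<omega> ^ n"
      using Suc.prems(1) ordinal_times_mono[of "\<omega> ^ n" \<delta> \<omega>] by (metis leD leI power_Suc)
    then obtain k \<gamma> where "\<delta> = \<omega> ^ k * (\<gamma> + 1)" using Suc.IH[of \<delta>] Suc.prems(2) multiple by auto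
    then have "\<beta> = \<omega> ^ Suc k * (\<gamma> + 1)" using multiple by (simp add: mult.assoc)
    then show ?thesis by blast
  next
    case (succ \<gamma>)
    then have "\<beta> = \<omega> ^ 0 * (\<gamma> + 1)" by simp
    then show ?thesis by blast
  qed
qed simp

text \<open>
  Cancelling the last \<open>1\<close> in \<open>(\<alpha> + 1) (\<beta> + 1) = \<omega>\<^sup>n + 1\<close> exhibits \<open>\<omega>\<^sup>n\<close> as the sum of \<open>(\<alpha> + 1) \<beta>\<close>
  and \<open>\<alpha>\<close>, but \<open>\<omega>\<^sup>n\<close> is additively indecomposable.
\<close>
lemma irreducible_omega_power_add_one:
  assumes "n > 0"
  shows "irreducible_in UNIV (\<omega> ^ n + 1)"
  unfolding irreducible_in_def
proof (intro ballI impI)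
  fix \<alpha> \<beta> :: "'a ordinal"
  assume prod: "\<alpha> * \<beta> = \<omega> ^ n + 1"
  then obtain \<alpha>' \<beta>' where succ: "\<alpha> = \<alpha>' + 1" "\<beta> = \<beta>' + 1" by (rule successor_times_successor)
  have "\<alpha> * \<beta>' + \<alpha>' + 1 = \<omega> ^ n + 1"
    using prod unfolding succ(2) ordinal_times_succ by (simp add: succ(1) add.assoc)
  then have sum: "\<alpha> * \<beta>' + \<alpha>' = \<omega> ^ n" by simp
  show "\<alpha> = 1 \<or> \<beta> = 1"
  proof (rule ccontr)
    assume "\<not> (\<alpha> = 1 \<or> \<beta> = 1)"
    then have "\<alpha>' \<noteq> 0" "\<beta>' \<noteq> 0" using succ by auto
    have "\<alpha> * \<beta>' < \<omega> ^ n"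
      using ordinal_add_strict_mono[of 0 \<alpha>' "\<alpha> * \<beta>'"] \<open>\<alpha>' \<noteq> 0\<close> sum by simp
    moreover have "\<alpha>' < \<alpha> * \<beta>'"
      using ordinal_le_times_right[OF \<open>\<beta>' \<noteq> 0\<close>, of \<alpha>] succ(1)
      by (metis less_le_trans ordinal_less_add_one)
    moreover have "\<omega> ^ n = \<omega> ^ (n - 1) * (\<omega> :: 'a ordinal)"
      using assms by (metis power_minus_mult)
    ultimately have "\<alpha> * \<beta>' + \<alpha>' < \<omega> ^ n"
      using add_less_times_omega[of "\<alpha> * \<beta>'" "\<omega> ^ (n - 1)" \<alpha>'] by (metis order_less_trans)
    then show False using sum by simp
  qed
qed

text \<open>
  Write \<open>\<sigma> = \<omega> \<beta> + m\<close> with \<open>m\<close> finite. Irreducibility first forces \<open>m = 1\<close>, since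
  \<open>\<sigma> = m (\<omega> \<beta> + 1)\<close>, and then \<open>\<gamma> = 0\<close> when \<open>\<beta> = \<omega>\<^sup>k (\<gamma> + 1)\<close>, since
  \<open>\<sigma> = (\<omega>\<^bsup>k+1\<^esup> + 1) (\<gamma> + 1)\<close>.
\<close>
lemma irreducible_imp_eq_omega_power_add_one:
  fixes \<sigma> :: "'a ordinal"
  assumes irreducible: "irreducible_in UNIV \<sigma>"
    and "\<sigma> \<noteq> \<omega>" and deg: "has_degree \<sigma> n" and "n > 0"
  shows "\<sigma> = \<omega> ^ n + 1"
proof -
  have factors: "\<alpha> = 1 \<or> \<beta> = 1" if "\<alpha> * \<beta> = \<sigma>" for \<alpha> \<beta>
    using irreducible that unfolding irreducible_in_def by blast
  have "\<sigma> \<noteq> 0" using deg by (rule has_degree_neq_zero)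
  obtain \<beta> m where \<sigma>: "\<sigma> = \<omega> * \<beta> + m" "m < \<omega>"
    using ordinal_division[OF omega_neq_zero] by blast
  have "\<beta> \<noteq> 0"
    using \<sigma> finite_imp_has_degree_zero[of \<sigma>] has_degree_unique[OF deg] \<open>\<sigma> \<noteq> 0\<close> \<open>n > 0\<close> by auto
  have "m \<noteq> 0" using factors[of \<omega> \<beta>] \<sigma>(1) \<open>\<sigma> \<noteq> \<omega>\<close> by auto
  then have "m * (\<omega> * \<beta> + 1) = \<sigma>"
    by (simp add: ordinal_distrib_left mult.assoc[symmetric] finite_times_omega \<sigma>)
  then have "m = 1 \<or> \<omega> * \<beta> + 1 = 1" by (rule factors)
  then have "m = 1" using \<open>\<beta> \<noteq> 0\<close> by simp
  have "\<beta> \<le> \<sigma>"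
    unfolding \<sigma>(1) using ordinal_le_times_left[of \<omega> \<beta>] ordinal_le_add order_trans by force
  also have "\<sigma> < \<omega> ^ Suc n" using less_times_omega[OF \<open>\<sigma> \<noteq> 0\<close>] deg by (simp add: has_degree_def)
  finally obtain k \<gamma> where "\<beta> = \<omega> ^ k * (\<gamma> + 1)"
    using less_omega_power_factor \<open>\<beta> \<noteq> 0\<close> by blast
  then have "(\<omega> ^ Suc k + 1) * (\<gamma> + 1) = \<sigma>"
    by (subst omega_power_add_one_times_succ) (simp_all add: \<sigma>(1) \<open>m = 1\<close> mult.assoc)
  then have "\<sigma> = \<omega> ^ Suc k + 1" using factors[of "\<omega> ^ Suc k + 1" "\<gamma> + 1"] by auto
  moreover from this have "n = Suc k"
    using has_degree_unique[OF deg] has_degree_omega_power_add_one[of "Suc k"] by simp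
  ultimately show ?thesis by simp
qed

lemma eq_omega_power_add_one_iff:
  fixes \<sigma> :: "'a ordinal"
  assumes "n > 0"
  shows "\<sigma> = \<omega> ^ n + 1 \<longleftrightarrow> irreducible_in UNIV \<sigma> \<and> \<sigma> \<noteq> \<omega> \<and> has_degree \<sigma> n"
proof -
  have "\<omega> ^ n + 1 \<noteq> (\<omega> :: 'a ordinal)"
    using limit_ordinal_omega not_limit_ordinal_add_one by metis
  then show ?thesis
    using irreducible_omega_power_add_one[OF assms] has_degree_omega_power_add_one
      irreducible_imp_eq_omega_power_add_one[OF _ _ _ assms] by metis
qed


section \<open>The domain\<close>

lemma ordinal_power_eq_ord_exp:
  assumes "\<alpha> \<noteq> 0"
  shows "\<exists>\<delta><\<omega>. \<alpha> ^ n = ord_exp \<alpha> \<delta>"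
proof (induction n)
  case 0
  then show ?case by (intro exI[of _ 0]) (simp add: ord_exp_zero)
next
  case (Suc n)
  then obtain \<delta> where "\<delta> < \<omega>" "\<alpha> ^ n = ord_exp \<alpha> \<delta>" by blast
  then show ?case
    using assms
    by (intro exI[of _ "\<delta> + 1"]) (simp add: ord_exp_succ add_one_less_omega power_Suc2 del: power_Suc)
qed

lemma omega_power_less_ord_exp:
  fixes \<beta> :: "'a ordinal"
  assumes "\<omega> \<le> \<beta>"
  shows "\<omega> ^ n < ord_exp \<omega> \<beta>"
proof -
  obtain \<delta> :: "'a ordinal" where \<delta>: "\<delta> < \<omega>" "\<omega> ^ n = ord_exp \<omega> \<delta>"
    using ordinal_power_eq_ord_exp[OF omega_neq_zero] by blast
  have "\<omega> ^ n < ord_exp \<omega> \<delta> * \<omega>" unfolding \<delta>(2)[symmetric] by (rule less_times_omega) simp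
  moreover have "\<delta> < \<beta>" using \<delta>(1) assms by (rule less_le_trans)
  moreover have "\<beta> \<noteq> 0" using assms by (metis omega_neq_zero order_antisym zero_le_ordinal)
  ultimately show ?thesis using less_ord_exp_iff by blast
qed

lemma has_degree_in_domain:
  assumes "l > 1" "has_degree \<xi> n"
  shows "\<xi> \<in> domain (\<Omega> l)"
proof -
  have "\<omega> = ord_exp \<omega> (0 + 1)" by (subst ord_exp_succ) (simp_all add: ord_exp_zero)
  also have "\<dots> \<le> ord_exp \<omega> l" using assms(1) by (intro ord_exp_mono) simp_all
  finally have "\<omega> ^ Suc n < ord_exp \<omega> (ord_exp \<omega> l)" by (rule omega_power_less_ord_exp)
  moreover have "\<xi> \<le> \<omega> ^ Suc n"
    using ordinal_le_times_right[of \<omega> \<xi>] assms(2) by (simp add: has_degree_def)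
  ultimately show ?thesis by (simp add: omega_structure_def)
qed

lemma omega_power_in_domain: "l > 1 \<Longrightarrow> \<omega> ^ n \<in> domain (\<Omega> l)"
  using has_degree_in_domain has_degree_omega_power by blast

lemma domain_omega_structure_neq_empty: "l > 1 \<Longrightarrow> domain (\<Omega> l) \<noteq> {}"
  using omega_power_in_domain by blast

lemma irreducible_in_domain_iff:
  assumes "l > 1" "has_degree \<sigma> n"
  shows "irreducible_in (domain (\<Omega> l)) \<sigma> \<longleftrightarrow> irreducible_in UNIV \<sigma>"
  using irreducible_in_lessThan[OF has_degree_neq_zero[OF assms(2)]] has_degree_in_domain[OF assms]
  by (simp add: omega_structure_def lessThan_def)


section \<open>Least common multiples\<close>

definition dvd_witness :: "'a ordinal \<Rightarrow> 'a ordinal \<Rightarrow> 'a ordinal \<Rightarrow> bool" where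
  "dvd_witness \<sigma> \<mu> \<xi> \<longleftrightarrow> \<xi> * \<sigma> = \<sigma> * \<xi> \<and> \<xi> * \<omega> = \<mu> * \<omega>"

definition no_smaller_common_multiple ::
  "'a ordinal set \<Rightarrow> 'a ordinal \<Rightarrow> 'a ordinal \<Rightarrow> 'a ordinal \<Rightarrow> bool" where
  "no_smaller_common_multiple D \<sigma> \<tau> \<kappa> \<longleftrightarrow>
     (\<forall>\<mu>\<in>D. \<forall>\<delta>\<in>D. \<forall>\<xi>\<in>D. \<forall>\<eta>\<in>D. \<not> ((\<exists>i. \<mu> = \<omega> ^ i) \<and> \<mu> \<noteq> 1 \<and> \<delta> \<noteq> 1 \<and> \<mu> * \<delta> = \<kappa> \<and>
        dvd_witness \<sigma> \<mu> \<xi> \<and> dvd_witness \<tau> \<mu> \<eta>))"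

lemma ex_dvd_witness_iff:
  assumes "l > 1" "n > 0"
  shows "(\<exists>\<xi>\<in>domain (\<Omega> l). dvd_witness (\<omega> ^ n + 1) (\<omega> ^ k) \<xi>) \<longleftrightarrow> n dvd k"
proof -
  have "dvd_witness (\<omega> ^ n + 1) (\<omega> ^ k) \<xi> \<longleftrightarrow>
      \<xi> * (\<omega> ^ n + 1) = (\<omega> ^ n + 1) * \<xi> \<and> has_degree \<xi> k" for \<xi> :: "'a ordinal"
    by (simp add: dvd_witness_def has_degree_def power_commutes)
  then show ?thesis
    using dvd_iff_commutes[OF assms(2), of k] has_degree_in_domain[OF assms(1)] by blast
qed

lemma no_smaller_common_multiple_iff:
  assumes "l > 1" "m > 0" "n > 0"
  shows "no_smaller_common_multiple (domain (\<Omega> l)) (\<omega> ^ m + 1) (\<omega> ^ n + 1) (\<omega> ^ k) \<longleftrightarrow>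
    (\<forall>i. 0 < i \<and> i < k \<longrightarrow> \<not> (m dvd i \<and> n dvd i))"
proof -
  let ?D = "domain (\<Omega> l)"
  have "(\<exists>\<delta>\<in>?D. \<delta> \<noteq> 1 \<and> \<omega> ^ i * \<delta> = \<omega> ^ k) \<longleftrightarrow> i < k" for i
    using omega_power_in_domain[OF assms(1)] by (auto simp: omega_power_times_eq_omega_power_iff)
  moreover have "no_smaller_common_multiple ?D (\<omega> ^ m + 1) (\<omega> ^ n + 1) (\<omega> ^ k) \<longleftrightarrow>
      (\<forall>i. \<omega> ^ i \<in> ?D \<and> (\<omega> ^ i :: 'a ordinal) \<noteq> 1 \<and> (\<exists>\<delta>\<in>?D. \<delta> \<noteq> 1 \<and> \<omega> ^ i * \<delta> = \<omega> ^ k) \<longrightarrow>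
        \<not> ((\<exists>\<xi>\<in>?D. dvd_witness (\<omega> ^ m + 1) (\<omega> ^ i) \<xi>) \<and> (\<exists>\<eta>\<in>?D. dvd_witness (\<omega> ^ n + 1) (\<omega> ^ i) \<eta>)))"
    unfolding no_smaller_common_multiple_def by blast
  ultimately show ?thesis
    using omega_power_in_domain[OF assms(1)] by (simp add: ex_dvd_witness_iff assms)
qed

lemma eq_lcm_iff:
  assumes "m > 0" "n > (0 :: nat)"
  shows "k = lcm m n \<longleftrightarrow>
    k > 0 \<and> m dvd k \<and> n dvd k \<and> (\<forall>i. 0 < i \<and> i < k \<longrightarrow> \<not> (m dvd i \<and> n dvd i))"
proof -
  have least: "lcm m n \<le> i" if "0 < i" "m dvd i" "n dvd i" for i
    using that by (intro dvd_imp_le lcm_least)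
  have pos: "lcm m n > 0" using assms by (simp add: lcm_pos_nat)
  show ?thesis
  proof
    assume "k = lcm m n"
    then show "k > 0 \<and> m dvd k \<and> n dvd k \<and> (\<forall>i. 0 < i \<and> i < k \<longrightarrow> \<not> (m dvd i \<and> n dvd i))"
      using pos least by (metis dvd_lcm1 dvd_lcm2 leD)
  next
    assume k: "k > 0 \<and> m dvd k \<and> n dvd k \<and> (\<forall>i. 0 < i \<and> i < k \<longrightarrow> \<not> (m dvd i \<and> n dvd i))"
    then have "\<not> lcm m n < k" using pos by (metis dvd_lcm1 dvd_lcm2)
    then show "k = lcm m n" using least k by (simp add: order_antisym)
  qed
qed

definition lcm_witnesses :: "'a ordinal set \<Rightarrow> 'a ordinal \<Rightarrow> 'a ordinal \<Rightarrow> 'a ordinal \<Rightarrow>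
    'a ordinal \<Rightarrow> 'a ordinal \<Rightarrow> 'a ordinal \<Rightarrow> 'a ordinal \<Rightarrow> bool" where
  "lcm_witnesses D \<alpha> \<beta> \<kappa> \<sigma> \<tau> \<xi> \<eta> \<longleftrightarrow>
     (\<exists>m>0. \<alpha> = \<omega> ^ m \<and> \<sigma> = \<omega> ^ m + 1) \<and> (\<exists>n>0. \<beta> = \<omega> ^ n \<and> \<tau> = \<omega> ^ n + 1) \<and>
     no_smaller_common_multiple D \<sigma> \<tau> \<kappa> \<and>
     (\<exists>k. \<kappa> = \<omega> ^ k) \<and> \<kappa> \<noteq> 1 \<and> dvd_witness \<sigma> \<kappa> \<xi> \<and> dvd_witness \<tau> \<kappa> \<eta>"

lemma ex_lcm_witnesses_iff:
  assumes "l > 1"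
  defines "D \<equiv> domain (\<Omega> l)"
  shows "(\<exists>\<sigma>\<in>D. \<exists>\<tau>\<in>D. \<exists>\<xi>\<in>D. \<exists>\<eta>\<in>D. lcm_witnesses D \<alpha> \<beta> \<kappa> \<sigma> \<tau> \<xi> \<eta>) \<longleftrightarrow>
    (\<exists>m n. m > 0 \<and> n > 0 \<and> \<alpha> = \<omega> ^ m \<and> \<beta> = \<omega> ^ n \<and> \<kappa> = \<omega> ^ lcm m n)" (is "?L \<longleftrightarrow> ?R")
proof
  assume ?L
  then obtain m n k where mn: "m > 0" "n > 0" and vals: "\<alpha> = \<omega> ^ m" "\<beta> = \<omega> ^ n" "\<kappa> = \<omega> ^ k"
    and "k \<noteq> 0" "no_smaller_common_multiple D (\<omega> ^ m + 1) (\<omega> ^ n + 1) (\<omega> ^ k)"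
    and "\<exists>\<xi>\<in>D. dvd_witness (\<omega> ^ m + 1) (\<omega> ^ k) \<xi>" "\<exists>\<eta>\<in>D. dvd_witness (\<omega> ^ n + 1) (\<omega> ^ k) \<eta>"
    unfolding lcm_witnesses_def by fastforce
  then have "k = lcm m n"
    unfolding D_def eq_lcm_iff[OF mn] ex_dvd_witness_iff[OF assms(1) mn(1)]
      ex_dvd_witness_iff[OF assms(1) mn(2)] no_smaller_common_multiple_iff[OF assms(1) mn] by blast
  then show ?R using mn vals by blast
next
  assume ?R
  then obtain m n where mn: "m > 0" "n > 0"
    and vals: "\<alpha> = \<omega> ^ m" "\<beta> = \<omega> ^ n" "\<kappa> = \<omega> ^ lcm m n" by blast
  have in_D: "\<omega> ^ i + 1 \<in> D" for i
    unfolding D_def using has_degree_in_domain[OF assms(1) has_degree_omega_power_add_one] by blast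
  obtain \<xi> \<eta> where "\<xi> \<in> D" "dvd_witness (\<omega> ^ m + 1) \<kappa> \<xi>" "\<eta> \<in> D" "dvd_witness (\<omega> ^ n + 1) \<kappa> \<eta>"
    using ex_dvd_witness_iff[OF assms(1) mn(1), of "lcm m n"]
      ex_dvd_witness_iff[OF assms(1) mn(2), of "lcm m n"]
    unfolding vals(3) D_def by auto
  moreover have "no_smaller_common_multiple D (\<omega> ^ m + 1) (\<omega> ^ n + 1) \<kappa>" "\<kappa> \<noteq> 1"
    using eq_lcm_iff[OF mn, of "lcm m n"] no_smaller_common_multiple_iff[OF assms(1) mn, of "lcm m n"]
    unfolding vals(3) D_def by auto
  ultimately have "lcm_witnesses D \<alpha> \<beta> \<kappa> (\<omega> ^ m + 1) (\<omega> ^ n + 1) \<xi> \<eta>"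
    unfolding lcm_witnesses_def using mn vals by blast
  then show ?L using in_D \<open>\<xi> \<in> D\<close> \<open>\<eta> \<in> D\<close> by blast
qed


section \<open>Multiplication of exponents\<close>

definition consecutive_lcm :: "'a ordinal \<Rightarrow> 'a ordinal \<Rightarrow> bool" where
  "consecutive_lcm \<alpha> \<beta> \<longleftrightarrow> (\<exists>n. \<alpha> = \<omega> ^ n \<and> \<beta> = \<omega> ^ lcm (n + 1) (n + 2))"

lemma consecutive_lcm_iff:
  "consecutive_lcm \<alpha> \<beta> \<longleftrightarrow> (\<exists>k. \<alpha> = \<omega> ^ k) \<and>
     (\<exists>m n. m > 0 \<and> n > 0 \<and> \<alpha> * \<omega> = \<omega> ^ m \<and> \<alpha> * \<omega> * \<omega> = \<omega> ^ n \<and> \<beta> = \<omega> ^ lcm m n)"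
  unfolding consecutive_lcm_def by (auto simp: omega_power_times_omega simp del: power_Suc)

lemma lcm_consecutive: "lcm (n + 1) (n + 2) = (n + 1) * (n + 2 :: nat)"
  using lcm_coprime[of "n + 1" "n + 2"] coprime_Suc_right_nat[of "n + 1"] by simp

text \<open>
  The product is isolated by \<open>(s + 1) (s + 2) + 2 = (i + 1) (i + 2) + (j + 1) (j + 2) + 2 i j\<close>, where
  \<open>s = i + j\<close>.
\<close>
lemma eq_omega_power_mult_iff:
  fixes l :: "'a ordinal"
  assumes "l > 1"
  defines "D \<equiv> domain (\<Omega> l)"
  shows "(\<exists>i j. \<alpha> = \<omega> ^ i \<and> \<beta> = \<omega> ^ j \<and> \<gamma> = \<omega> ^ (i * j)) \<longleftrightarrow>
    (\<exists>\<alpha>'\<in>D. \<exists>\<beta>'\<in>D. \<exists>\<sigma>\<in>D.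
       consecutive_lcm \<alpha> \<alpha>' \<and> consecutive_lcm \<beta> \<beta>' \<and> consecutive_lcm (\<alpha> * \<beta>) \<sigma> \<and>
       (\<exists>k. \<gamma> = \<omega> ^ k) \<and> \<sigma> * \<omega> * \<omega> = \<alpha>' * \<beta>' * \<gamma> * \<gamma>)" (is "?L \<longleftrightarrow> ?R")
proof -
  have exponent: "\<omega> ^ lcm (i + j + 1) (i + j + 2) * \<omega> * \<omega> =
      \<omega> ^ lcm (i + 1) (i + 2) * \<omega> ^ lcm (j + 1) (j + 2) * \<omega> ^ k * \<omega> ^ k \<longleftrightarrow> k = i * j" for i j k
    unfolding lcm_consecutive omega_power_times_omega power_add[symmetric] omega_power_inject
    by (auto simp: algebra_simps)
  show ?thesis
  proof
    assume ?L
    then obtain i j where vals: "\<alpha> = \<omega> ^ i" "\<beta> = \<omega> ^ j" "\<gamma> = \<omega> ^ (i * j)" by blast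
    have lcm: "consecutive_lcm (\<omega> ^ n) (\<omega> ^ lcm (n + 1) (n + 2))" for n
      unfolding consecutive_lcm_def by blast
    have "\<omega> ^ n \<in> D" for n unfolding D_def using assms(1) by (rule omega_power_in_domain)
    then show ?R
      using lcm[of i] lcm[of j] lcm[of "i + j"] exponent[of i j "i * j"]
      unfolding vals power_add[symmetric, of \<omega> i j] by blast
  next
    assume ?R
    then obtain i j s k where vals: "\<alpha> = \<omega> ^ i" "\<beta> = \<omega> ^ j" "\<gamma> = \<omega> ^ k" and "\<alpha> * \<beta> = \<omega> ^ s"
      and eq: "\<omega> ^ lcm (s + 1) (s + 2) * \<omega> * \<omega> =
        \<omega> ^ lcm (i + 1) (i + 2) * \<omega> ^ lcm (j + 1) (j + 2) * \<omega> ^ k * (\<omega> ^ k :: 'a ordinal)"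
      unfolding consecutive_lcm_def by blast
    then have "s = i + j" by (simp add: power_add[symmetric])
    then have "k = i * j" using eq exponent by blast
    then show ?L using vals by blast
  qed
qed


section \<open>Definability by formulas with a fixed number of universal quantifiers\<close>

lemma val_cong: "(\<And>i. i \<in> trm_vars t \<Longrightarrow> e i = e' i) \<Longrightarrow> val M e t = val M e' t"
  by (induction t) auto

lemma val_fun_upd_fresh: "i \<notin> trm_vars t \<Longrightarrow> val M (e(i := a)) t = val M e t"
  by (rule val_cong) auto

lemma sat_fun_upd_fresh: "i \<notin> free_vars \<phi> \<Longrightarrow> sat M (e(i := a)) \<phi> \<longleftrightarrow> sat M e \<phi>"
proof (induction \<phi> arbitrary: e)
  case (Ex j \<phi>)
  then show ?case by (cases "i = j") (simp_all add: fun_upd_twist[of i j] del: fun_upd_apply)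
next
  case (All j \<phi>)
  then show ?case by (cases "i = j") (simp_all add: fun_upd_twist[of i j] del: fun_upd_apply)
qed (auto simp: val_fun_upd_fresh)

lemma free_vars_foldr_Ex: "free_vars (foldr Ex us \<phi>) = free_vars \<phi> - set us"
  by (induction us) auto

lemma free_vars_foldr_All: "free_vars (foldr All vs \<phi>) = free_vars \<phi> - set vs"
  by (induction vs) auto

lemma sat_foldr_Ex_cong:
  "(\<And>e. sat M e \<phi> \<longleftrightarrow> sat M e \<psi>) \<Longrightarrow> sat M e (foldr Ex us \<phi>) \<longleftrightarrow> sat M e (foldr Ex us \<psi>)"
  by (induction us arbitrary: e) auto

lemma sat_foldr_All_Conj:
  "sat M e (foldr All vs (Conj \<phi> \<psi>)) \<longleftrightarrow> sat M e (foldr All vs \<phi>) \<and> sat M e (foldr All vs \<psi>)"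
  by (induction vs arbitrary: e) auto

lemma sat_foldr_Ex_Conj_left:
  "set us \<inter> free_vars \<psi> = {} \<Longrightarrow>
     sat M e (foldr Ex us (Conj \<phi> \<psi>)) \<longleftrightarrow> sat M e (foldr Ex us \<phi>) \<and> sat M e \<psi>"
  by (induction us arbitrary: e) (auto simp: sat_fun_upd_fresh)

lemma sat_foldr_Ex_Conj_right:
  "set us \<inter> free_vars \<phi> = {} \<Longrightarrow>
     sat M e (foldr Ex us (Conj \<phi> \<psi>)) \<longleftrightarrow> sat M e \<phi> \<and> sat M e (foldr Ex us \<psi>)"
  by (induction us arbitrary: e) (auto simp: sat_fun_upd_fresh)

lemma sat_foldr_Ex_append_foldr_All_Conj:
  assumes "set us' \<inter> free_vars (foldr All vs \<phi>) = {}"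
    and "set us \<inter> free_vars (foldr Ex us' (foldr All vs \<psi>)) = {}"
  shows "sat M e (foldr Ex (us @ us') (foldr All vs (Conj \<phi> \<psi>))) \<longleftrightarrow>
    sat M e (foldr Ex us (foldr All vs \<phi>)) \<and> sat M e (foldr Ex us' (foldr All vs \<psi>))"
proof -
  let ?\<phi> = "foldr All vs \<phi>" and ?\<psi> = "foldr All vs \<psi>"
  have "sat M e (foldr Ex (us @ us') (foldr All vs (Conj \<phi> \<psi>))) \<longleftrightarrow>
      sat M e (foldr Ex (us @ us') (Conj ?\<phi> ?\<psi>))"
    by (rule sat_foldr_Ex_cong) (simp add: sat_foldr_All_Conj)
  also have "\<dots> \<longleftrightarrow> sat M e (foldr Ex us (Conj ?\<phi> (foldr Ex us' ?\<psi>)))"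
    unfolding foldr_append by (rule sat_foldr_Ex_cong) (simp add: sat_foldr_Ex_Conj_right assms(1))
  also have "\<dots> \<longleftrightarrow> sat M e (foldr Ex us ?\<phi>) \<and> sat M e (foldr Ex us' ?\<psi>)"
    by (rule sat_foldr_Ex_Conj_left[OF assms(2)])
  finally show ?thesis .
qed

definition definable_term ::
  "('c, 'b, 'd) fo_structure \<Rightarrow> nat set \<Rightarrow> ((nat \<Rightarrow> 'd) \<Rightarrow> 'd) \<Rightarrow> bool" where
  "definable_term M A f \<longleftrightarrow> (\<exists>t. trm_vars t \<subseteq> A \<and> (\<forall>e. val M e t = f e))"

definition definable_qf ::
  "('c, 'b, 'd) fo_structure \<Rightarrow> nat set \<Rightarrow> ((nat \<Rightarrow> 'd) \<Rightarrow> bool) \<Rightarrow> bool" where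
  "definable_qf M A P \<longleftrightarrow>
     (\<exists>\<phi>. quantifier_free \<phi> \<and> free_vars \<phi> \<subseteq> A \<and> (\<forall>e. sat M e \<phi> \<longleftrightarrow> P e))"

definition definable_forall ::
  "('c, 'b, 'd) fo_structure \<Rightarrow> nat \<Rightarrow> nat set \<Rightarrow> ((nat \<Rightarrow> 'd) \<Rightarrow> bool) \<Rightarrow> bool" where
  "definable_forall M k A P \<longleftrightarrow>
     (\<forall>vs. length vs = k \<longrightarrow> distinct vs \<longrightarrow> set vs \<inter> A = {} \<longrightarrow>
        (\<exists>\<phi>. quantifier_free \<phi> \<and> free_vars \<phi> \<subseteq> A \<union> set vs \<and>
           (\<forall>e. sat M e (foldr All vs \<phi>) \<longleftrightarrow> P e)))"

text \<open>
  The names \<open>vs\<close> of the universally quantified variables are prescribed, so that two formulas can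
  share them, and the existentially quantified ones avoid any prescribed finite set \<open>X\<close>, so that they
  can be kept apart.
\<close>
definition definable_exists_forall ::
  "('c, 'b, 'd) fo_structure \<Rightarrow> nat \<Rightarrow> nat set \<Rightarrow> ((nat \<Rightarrow> 'd) \<Rightarrow> bool) \<Rightarrow> bool" where
  "definable_exists_forall M k A P \<longleftrightarrow>
     (\<forall>vs X. length vs = k \<longrightarrow> distinct vs \<longrightarrow> set vs \<inter> A = {} \<longrightarrow> finite X \<longrightarrow>
        (\<exists>us \<phi>. distinct us \<and> set us \<inter> X = {} \<and> quantifier_free \<phi> \<and>
           free_vars \<phi> \<subseteq> A \<union> set us \<union> set vs \<and>
           (\<forall>e. sat M e (foldr Ex us (foldr All vs \<phi>)) \<longleftrightarrow> P e)))"

lemma definable_exists_forallE: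
  assumes "definable_exists_forall M k A P"
    and "length vs = k" "distinct vs" "set vs \<inter> A = {}" "finite X"
  obtains us \<phi> where "distinct us" "set us \<inter> X = {}" "quantifier_free \<phi>"
    "free_vars \<phi> \<subseteq> A \<union> set us \<union> set vs" "\<And>e. sat M e (foldr Ex us (foldr All vs \<phi>)) \<longleftrightarrow> P e"
  using assms(1)[unfolded definable_exists_forall_def, rule_format, OF assms(2-5)] that by blast

lemma definable_term_var: "i \<in> A \<Longrightarrow> definable_term M A (\<lambda>e. e i)"
  unfolding definable_term_def by (intro exI[of _ "Var i"]) simp

lemma definable_term_const: "definable_term M A (\<lambda>e. const_of M c)"
  unfolding definable_term_def by (intro exI[of _ "Const c"]) simp

lemma definable_term_bin:
  assumes "definable_term M A f" "definable_term M A g"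
  shows "definable_term M A (\<lambda>e. bin_of M b (f e) (g e))"
proof -
  obtain s t where "trm_vars s \<subseteq> A" "\<And>e. val M e s = f e" "trm_vars t \<subseteq> A" "\<And>e. val M e t = g e"
    using assms unfolding definable_term_def by blast
  then show ?thesis unfolding definable_term_def by (intro exI[of _ "Bin b s t"]) simp
qed

lemma definable_term_mono: "definable_term M A f \<Longrightarrow> A \<subseteq> B \<Longrightarrow> definable_term M B f"
  unfolding definable_term_def by blast

lemma definable_term_fun_upd: "definable_term M A f \<Longrightarrow> i \<notin> A \<Longrightarrow> f (e(i := a)) = f e"
  unfolding definable_term_def by (metis subsetD val_fun_upd_fresh)

lemma definable_qf_eq:
  assumes "definable_term M A f" "definable_term M A g"
  shows "definable_qf M A (\<lambda>e. f e = g e)"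
proof -
  obtain s t where "trm_vars s \<subseteq> A" "\<And>e. val M e s = f e" "trm_vars t \<subseteq> A" "\<And>e. val M e t = g e"
    using assms unfolding definable_term_def by blast
  then show ?thesis unfolding definable_qf_def by (intro exI[of _ "Eq s t"]) simp
qed

lemma definable_qf_not:
  assumes "definable_qf M A P"
  shows "definable_qf M A (\<lambda>e. \<not> P e)"
proof -
  obtain \<phi> where "quantifier_free \<phi>" "free_vars \<phi> \<subseteq> A" "\<And>e. sat M e \<phi> \<longleftrightarrow> P e"
    using assms unfolding definable_qf_def by blast
  then show ?thesis unfolding definable_qf_def by (intro exI[of _ "Neg \<phi>"]) simp
qed

lemma definable_qf_conj:
  assumes "definable_qf M A P" "definable_qf M A Q"
  shows "definable_qf M A (\<lambda>e. P e \<and> Q e)"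
proof -
  obtain \<phi> \<psi> where "quantifier_free \<phi>" "free_vars \<phi> \<subseteq> A" "\<And>e. sat M e \<phi> \<longleftrightarrow> P e"
    and "quantifier_free \<psi>" "free_vars \<psi> \<subseteq> A" "\<And>e. sat M e \<psi> \<longleftrightarrow> Q e"
    using assms unfolding definable_qf_def by blast
  then show ?thesis unfolding definable_qf_def by (intro exI[of _ "Conj \<phi> \<psi>"]) simp
qed

lemma definable_qf_imp:
  assumes "definable_qf M A P" "definable_qf M A Q"
  shows "definable_qf M A (\<lambda>e. P e \<longrightarrow> Q e)"
  using definable_qf_not[OF definable_qf_conj[OF assms(1) definable_qf_not[OF assms(2)]]] by simp

lemma definable_qf_disj:
  assumes "definable_qf M A P" "definable_qf M A Q"
  shows "definable_qf M A (\<lambda>e. P e \<or> Q e)"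
  using definable_qf_imp[OF definable_qf_not[OF assms(1)] assms(2)] by (simp add: disj_imp)

lemma definable_forall_qf: "definable_qf M A P \<Longrightarrow> definable_forall M 0 A P"
  unfolding definable_qf_def definable_forall_def by simp

lemma definable_forall_ball:
  assumes "\<And>x. x \<notin> A \<Longrightarrow> definable_forall M k (insert x A) (\<lambda>e. P e (e x))"
    and "\<And>e x a b. x \<notin> A \<Longrightarrow> P (e(x := a)) b \<longleftrightarrow> P e b"
  shows "definable_forall M (Suc k) A (\<lambda>e. \<forall>a\<in>domain M. P e a)"
  unfolding definable_forall_def
proof (intro allI impI)
  fix vs' :: "nat list"
  assume vs': "length vs' = Suc k" "distinct vs'" "set vs' \<inter> A = {}"
  then obtain v vs where vs: "vs' = v # vs" by (cases vs') auto
  then have "v \<notin> A" "length vs = k" "distinct vs" "set vs \<inter> insert v A = {}" using vs' by auto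
  then obtain \<phi> where "quantifier_free \<phi>" "free_vars \<phi> \<subseteq> insert v A \<union> set vs"
    "\<And>e. sat M e (foldr All vs \<phi>) \<longleftrightarrow> P e (e v)"
    using assms(1)[OF \<open>v \<notin> A\<close>] unfolding definable_forall_def by blast
  then show "\<exists>\<phi>. quantifier_free \<phi> \<and> free_vars \<phi> \<subseteq> A \<union> set vs' \<and>
      (\<forall>e. sat M e (foldr All vs' \<phi>) \<longleftrightarrow> (\<forall>a\<in>domain M. P e a))"
    using assms(2)[OF \<open>v \<notin> A\<close>] by (intro exI[of _ \<phi>]) (auto simp: vs)
qed

lemma definable_exists_forall_forall:
  assumes "definable_forall M k A P"
  shows "definable_exists_forall M k A P"
  unfolding definable_exists_forall_def
proof (intro allI impI)
  fix vs :: "nat list" and X :: "nat set"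
  assume "length vs = k" "distinct vs" "set vs \<inter> A = {}"
  then obtain \<phi> where "quantifier_free \<phi>" "free_vars \<phi> \<subseteq> A \<union> set vs"
    "\<forall>e. sat M e (foldr All vs \<phi>) \<longleftrightarrow> P e"
    using assms unfolding definable_forall_def by blast
  then show "\<exists>us \<phi>. distinct us \<and> set us \<inter> X = {} \<and> quantifier_free \<phi> \<and>
      free_vars \<phi> \<subseteq> A \<union> set us \<union> set vs \<and> (\<forall>e. sat M e (foldr Ex us (foldr All vs \<phi>)) \<longleftrightarrow> P e)"
    by (intro exI[of _ "[]"] exI[of _ \<phi>]) simp
qed

lemma definable_exists_forall_Suc:
  assumes "domain M \<noteq> {}" "definable_exists_forall M k A P"
  shows "definable_exists_forall M (Suc k) A P"
  unfolding definable_exists_forall_def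
proof (intro allI impI)
  fix vs' :: "nat list" and X :: "nat set"
  assume vs': "length vs' = Suc k" "distinct vs'" "set vs' \<inter> A = {}" and "finite X"
  then obtain v vs where vs: "vs' = v # vs" by (cases vs') auto
  then have "length vs = k" "distinct vs" "set vs \<inter> A = {}" "finite (insert v X)"
    using vs' \<open>finite X\<close> by auto
  then obtain us \<phi> where us: "distinct us" "set us \<inter> insert v X = {}"
    and \<phi>: "quantifier_free \<phi>" "free_vars \<phi> \<subseteq> A \<union> set us \<union> set vs"
    and sat: "\<And>e. sat M e (foldr Ex us (foldr All vs \<phi>)) \<longleftrightarrow> P e"
    by (rule definable_exists_forallE[OF assms(2)]) (rule that)
  have "v \<notin> free_vars (foldr All vs \<phi>)" using us(2) \<phi>(2) vs vs' by (auto simp: free_vars_foldr_All)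
  then have "sat M e (foldr All vs' \<phi>) \<longleftrightarrow> sat M e (foldr All vs \<phi>)" for e
    using assms(1) by (auto simp: vs sat_fun_upd_fresh)
  then have "sat M e (foldr Ex us (foldr All vs' \<phi>)) \<longleftrightarrow> P e" for e
    unfolding sat[symmetric] by (rule sat_foldr_Ex_cong)
  then show "\<exists>us \<phi>. distinct us \<and> set us \<inter> X = {} \<and> quantifier_free \<phi> \<and>
      free_vars \<phi> \<subseteq> A \<union> set us \<union> set vs' \<and> (\<forall>e. sat M e (foldr Ex us (foldr All vs' \<phi>)) \<longleftrightarrow> P e)"
    using us \<phi> by (intro exI[of _ us] exI[of _ \<phi>]) (auto simp: vs)
qed

lemma definable_exists_forall_mono:
  assumes "domain M \<noteq> {}" "k \<le> k'" "definable_exists_forall M k A P"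
  shows "definable_exists_forall M k' A P"
  using assms(2,3)
  by (induction rule: dec_induct) (auto intro: definable_exists_forall_Suc[OF assms(1)])

lemma definable_exists_forall_qf:
  assumes "domain M \<noteq> {}" "definable_qf M A P"
  shows "definable_exists_forall M k A P"
  using definable_exists_forall_mono[OF assms(1) le0]
    definable_exists_forall_forall[OF definable_forall_qf[OF assms(2)]] by blast

lemma definable_exists_forall_conj:
  assumes "definable_exists_forall M k A P" "definable_exists_forall M k A Q" "finite A"
  shows "definable_exists_forall M k A (\<lambda>e. P e \<and> Q e)"
  unfolding definable_exists_forall_def
proof (intro allI impI)
  fix vs :: "nat list" and X :: "nat set"
  assume vs: "length vs = k" "distinct vs" "set vs \<inter> A = {}" and "finite X"
  then have finite: "finite (X \<union> A \<union> set vs)" using assms(3) by simp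
  obtain us \<phi> where us: "distinct us" "set us \<inter> (X \<union> A \<union> set vs) = {}"
    and \<phi>: "quantifier_free \<phi>" "free_vars \<phi> \<subseteq> A \<union> set us \<union> set vs"
      "\<And>e. sat M e (foldr Ex us (foldr All vs \<phi>)) \<longleftrightarrow> P e"
    by (rule definable_exists_forallE[OF assms(1) vs finite]) (rule that)
  have "finite (X \<union> A \<union> set vs \<union> set us)" using finite by simp
  then obtain us' \<psi> where us': "distinct us'" "set us' \<inter> (X \<union> A \<union> set vs \<union> set us) = {}"
    and \<psi>: "quantifier_free \<psi>" "free_vars \<psi> \<subseteq> A \<union> set us' \<union> set vs"
      "\<And>e. sat M e (foldr Ex us' (foldr All vs \<psi>)) \<longleftrightarrow> Q e"
    by (rule definable_exists_forallE[OF assms(2) vs]) (rule that)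
  have "set us' \<inter> free_vars (foldr All vs \<phi>) = {}"
    "set us \<inter> free_vars (foldr Ex us' (foldr All vs \<psi>)) = {}"
    using us(2) us'(2) \<phi>(2) \<psi>(2) by (auto simp: free_vars_foldr_All free_vars_foldr_Ex)
  then have "sat M e (foldr Ex (us @ us') (foldr All vs (Conj \<phi> \<psi>))) \<longleftrightarrow> P e \<and> Q e" for e
    by (simp add: sat_foldr_Ex_append_foldr_All_Conj \<phi>(3) \<psi>(3) del: foldr_append)
  then show "\<exists>us \<phi>. distinct us \<and> set us \<inter> X = {} \<and> quantifier_free \<phi> \<and>
      free_vars \<phi> \<subseteq> A \<union> set us \<union> set vs \<and> (\<forall>e. sat M e (foldr Ex us (foldr All vs \<phi>)) \<longleftrightarrow> P e \<and> Q e)"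
    using us us' \<phi>(1,2) \<psi>(1,2) by (intro exI[of _ "us @ us'"] exI[of _ "Conj \<phi> \<psi>"]) auto
qed

lemma definable_exists_forall_bex:
  assumes "\<And>x. x \<notin> A \<Longrightarrow> definable_exists_forall M k (insert x A) (\<lambda>e. P e (e x))"
    and "\<And>e x a b. x \<notin> A \<Longrightarrow> P (e(x := a)) b \<longleftrightarrow> P e b" and "finite A"
  shows "definable_exists_forall M k A (\<lambda>e. \<exists>a\<in>domain M. P e a)"
  unfolding definable_exists_forall_def
proof (intro allI impI)
  fix vs :: "nat list" and X :: "nat set"
  assume vs: "length vs = k" "distinct vs" "set vs \<inter> A = {}" and "finite X"
  then have "\<exists>x. x \<notin> A \<union> X \<union> set vs"
    using assms(3) by (intro ex_new_if_finite infinite_UNIV_nat) simp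
  then obtain x where x: "x \<notin> A" "x \<notin> X" "x \<notin> set vs" by blast
  then have "set vs \<inter> insert x A = {}" "finite (insert x X)" using vs(3) \<open>finite X\<close> by auto
  then obtain us \<phi> where us: "distinct us" "set us \<inter> insert x X = {}"
    and \<phi>: "quantifier_free \<phi>" "free_vars \<phi> \<subseteq> insert x A \<union> set us \<union> set vs"
    and sat: "\<And>e. sat M e (foldr Ex us (foldr All vs \<phi>)) \<longleftrightarrow> P e (e x)"
    by (rule definable_exists_forallE[OF assms(1)[OF x(1)] vs(1,2)]) (rule that)
  have "sat M e (foldr Ex (x # us) (foldr All vs \<phi>)) \<longleftrightarrow> (\<exists>a\<in>domain M. P e a)" for e
    using assms(2)[OF x(1)] by (simp add: sat)
  then show "\<exists>us \<phi>. distinct us \<and> set us \<inter> X = {} \<and> quantifier_free \<phi> \<and>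
      free_vars \<phi> \<subseteq> A \<union> set us \<union> set vs \<and>
      (\<forall>e. sat M e (foldr Ex us (foldr All vs \<phi>)) \<longleftrightarrow> (\<exists>a\<in>domain M. P e a))"
    using us \<phi> x by (intro exI[of _ "x # us"] exI[of _ \<phi>]) auto
qed

lemma definable_exists_forall_finite_ball:
  assumes "finite I" "\<And>i. i \<in> I \<Longrightarrow> definable_exists_forall M k A (P i)"
    and "definable_exists_forall M k A Q" "finite A"
  shows "definable_exists_forall M k A (\<lambda>e. (\<forall>i\<in>I. P i e) \<and> Q e)"
  using assms(1,2)
proof (induction I)
  case (insert i I)
  then have "definable_exists_forall M k A (\<lambda>e. P i e \<and> (\<forall>i\<in>I. P i e) \<and> Q e)"
    using assms(4) by (intro definable_exists_forall_conj[of M k A "P i"]) auto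
  then show ?case by (simp add: conj_assoc)
qed (simp add: assms(3))

lemma definable_exists_forall_imp_defines_relation:
  assumes "definable_exists_forall M k {..<p} P"
  shows "\<exists>m \<Phi>. exists_forall_form m k \<Phi> \<and>
    defines_relation M p \<Phi> {xs. length xs = p \<and> set xs \<subseteq> domain M \<and> P ((!) xs)}"
proof -
  define vs where "vs = [p..<p + k]"
  have vs: "length vs = k" "distinct vs" "set vs \<inter> {..<p} = {}" unfolding vs_def by auto
  obtain us \<phi> where us: "distinct us" "set us \<inter> set vs = {}"
    and \<phi>: "quantifier_free \<phi>" "free_vars \<phi> \<subseteq> {..<p} \<union> set us \<union> set vs"
    and sat: "\<And>e. sat M e (foldr Ex us (foldr All vs \<phi>)) \<longleftrightarrow> P e"
    by (rule definable_exists_forallE[OF assms vs finite_set[of vs]]) (rule that)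
  let ?\<Phi> = "foldr Ex us (foldr All vs \<phi>)"
  have "exists_forall_form (length us) k ?\<Phi>"
    unfolding exists_forall_form_def using us vs(1,2) \<phi>(1)
    by (intro exI[of _ us] exI[of _ vs] exI[of _ \<phi>]) auto
  moreover have "free_vars ?\<Phi> \<subseteq> {..<p}"
    using \<phi>(2) by (auto simp: free_vars_foldr_Ex free_vars_foldr_All)
  then have "defines_relation M p ?\<Phi> {xs. length xs = p \<and> set xs \<subseteq> domain M \<and> P ((!) xs)}"
    by (simp add: defines_relation_def sat)
  ultimately show ?thesis by (intro exI conjI)
qed


section \<open>Definability of arithmetic on exponents\<close>

lemma omega_structure_simps [simp]:
  "bin_of (\<Omega> l) O_times = (*)"
  "const_of (\<Omega> l) C_one = 1"
  "const_of (\<Omega> l) C_omega = \<omega>"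
  "const_of (\<Omega> l) C_omega_plus_one = \<omega> + 1"
  by (simp_all add: omega_structure_def)

lemma definable_term_times:
  assumes "definable_term (\<Omega> l) A f" "definable_term (\<Omega> l) A g"
  shows "definable_term (\<Omega> l) A (\<lambda>e. f e * g e)"
  using definable_term_bin[OF assms, of O_times] by simp

lemma definable_term_one: "definable_term (\<Omega> l) A (\<lambda>e. 1)"
  using definable_term_const[of "\<Omega> l" A C_one] by simp

lemma definable_term_omega: "definable_term (\<Omega> l) A (\<lambda>e. \<omega>)"
  using definable_term_const[of "\<Omega> l" A C_omega] by simp

lemma definable_term_omega_add_one: "definable_term (\<Omega> l) A (\<lambda>e. \<omega> + 1)"
  using definable_term_const[of "\<Omega> l" A C_omega_plus_one] by simp

lemmas definable_qf_intros =
  definable_qf_eq definable_qf_not definable_qf_conj definable_qf_disj definable_qf_imp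
  definable_term_times definable_term_one definable_term_omega definable_term_omega_add_one
  definable_term_var

lemmas definable_exists_forall_intros =
  definable_exists_forall_bex definable_exists_forall_conj domain_omega_structure_neq_empty

lemma definable_qf_omega_power:
  assumes "definable_term (\<Omega> l) A f"
  shows "definable_qf (\<Omega> l) A (\<lambda>e. \<exists>k. f e = \<omega> ^ k)"
proof -
  have "(\<exists>k. f e = \<omega> ^ k) \<longleftrightarrow> f e * \<omega> = \<omega> * f e \<and> f e * \<omega> \<noteq> f e" for e
    by (auto simp: commutes_omega_iff)
  moreover have "definable_qf (\<Omega> l) A (\<lambda>e. f e * \<omega> = \<omega> * f e \<and> f e * \<omega> \<noteq> f e)"
    by (intro definable_qf_intros assms)
  ultimately show ?thesis by simp
qed

lemma definable_qf_has_degree: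
  assumes "definable_term (\<Omega> l) A f" "definable_term (\<Omega> l) A g"
  shows "definable_qf (\<Omega> l) A (\<lambda>e. \<exists>k. f e = \<omega> ^ k \<and> has_degree (g e) k)"
proof -
  have "(\<exists>k. f e = \<omega> ^ k \<and> has_degree (g e) k) \<longleftrightarrow> (\<exists>k. f e = \<omega> ^ k) \<and> g e * \<omega> = f e * \<omega>" for e
    by (auto simp: has_degree_def power_commutes)
  moreover have "definable_qf (\<Omega> l) A (\<lambda>e. (\<exists>k. f e = \<omega> ^ k) \<and> g e * \<omega> = f e * \<omega>)"
    by (intro definable_qf_intros definable_qf_omega_power assms)
  ultimately show ?thesis by simp
qed

lemma definable_forall_irreducible_in:
  assumes "definable_term (\<Omega> l) A f"
  shows "definable_forall (\<Omega> l) 2 A (\<lambda>e. irreducible_in (domain (\<Omega> l)) (f e))"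
  unfolding irreducible_in_def numeral_2_eq_2
  by (intro definable_forall_ball definable_forall_qf definable_qf_intros)
    (auto simp: definable_term_fun_upd[OF assms] intro: definable_term_mono[OF assms])

lemma definable_exists_forall_omega_power_add_one:
  assumes "l > 1" "finite A" "definable_term (\<Omega> l) A f" "definable_term (\<Omega> l) A g"
  shows "definable_exists_forall (\<Omega> l) 2 A (\<lambda>e. \<exists>n>0. f e = \<omega> ^ n \<and> g e = \<omega> ^ n + 1)"
proof -
  let ?M = "\<Omega> l"
  have "(\<exists>n>0. f e = \<omega> ^ n \<and> g e = \<omega> ^ n + 1) \<longleftrightarrow>
      irreducible_in (domain ?M) (g e) \<and>
      (f e \<noteq> 1 \<and> g e \<noteq> \<omega> \<and> (\<exists>n. f e = \<omega> ^ n \<and> has_degree (g e) n))" for e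
    using irreducible_in_domain_iff[OF assms(1)] eq_omega_power_add_one_iff[of _ "g e"]
    by (metis bot_nat_0.not_eq_extremum omega_power_eq_one_iff)
  moreover have "definable_exists_forall ?M 2 A (\<lambda>e. irreducible_in (domain ?M) (g e) \<and>
      (f e \<noteq> 1 \<and> g e \<noteq> \<omega> \<and> (\<exists>n. f e = \<omega> ^ n \<and> has_degree (g e) n)))"
    by (intro definable_exists_forall_intros
        definable_exists_forall_forall[OF definable_forall_irreducible_in]
        definable_exists_forall_qf definable_qf_has_degree definable_qf_intros assms)
  ultimately show ?thesis by simp
qed

lemma definable_qf_dvd_witness:
  assumes "definable_term (\<Omega> l) A f" "definable_term (\<Omega> l) A g" "definable_term (\<Omega> l) A h"
  shows "definable_qf (\<Omega> l) A (\<lambda>e. dvd_witness (f e) (g e) (h e))"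
  unfolding dvd_witness_def by (intro definable_qf_intros assms)

lemma definable_forall_no_smaller_common_multiple:
  assumes "definable_term (\<Omega> l) A f" "definable_term (\<Omega> l) A g" "definable_term (\<Omega> l) A h"
  shows "definable_forall (\<Omega> l) 4 A
    (\<lambda>e. no_smaller_common_multiple (domain (\<Omega> l)) (f e) (g e) (h e))"
  unfolding no_smaller_common_multiple_def eval_nat_numeral BitM.simps
  by (intro definable_forall_ball definable_forall_qf definable_qf_intros definable_qf_omega_power
        definable_qf_dvd_witness)
    (auto simp: assms[THEN definable_term_fun_upd] intro: assms[THEN definable_term_mono])

lemma definable_exists_forall_lcm:
  assumes "l > 1" "finite A"
    and terms: "definable_term (\<Omega> l) A f" "definable_term (\<Omega> l) A g" "definable_term (\<Omega> l) A h"
  shows "definable_exists_forall (\<Omega> l) 4 A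
    (\<lambda>e. \<exists>m n. m > 0 \<and> n > 0 \<and> f e = \<omega> ^ m \<and> g e = \<omega> ^ n \<and> h e = \<omega> ^ lcm m n)"
  unfolding ex_lcm_witnesses_iff[OF assms(1), symmetric] unfolding lcm_witnesses_def
  by (intro definable_exists_forall_intros
        definable_exists_forall_mono[OF _ _ definable_exists_forall_omega_power_add_one]
        definable_exists_forall_forall[OF definable_forall_no_smaller_common_multiple]
        definable_exists_forall_qf definable_qf_omega_power definable_qf_dvd_witness
        definable_qf_intros assms(1))
    (auto simp: assms(2) terms[THEN definable_term_fun_upd] intro: terms[THEN definable_term_mono])

lemma definable_exists_forall_consecutive_lcm:
  assumes "l > 1" "finite A" "definable_term (\<Omega> l) A f" "definable_term (\<Omega> l) A g"
  shows "definable_exists_forall (\<Omega> l) 4 A (\<lambda>e. consecutive_lcm (f e) (g e))"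
  unfolding consecutive_lcm_iff
  by (intro definable_exists_forall_intros definable_exists_forall_lcm
      definable_exists_forall_qf definable_qf_omega_power definable_qf_intros assms)

lemma definable_exists_forall_mult_exponents:
  assumes "l > 1" "finite A"
    and terms: "definable_term (\<Omega> l) A f" "definable_term (\<Omega> l) A g" "definable_term (\<Omega> l) A h"
  shows "definable_exists_forall (\<Omega> l) 4 A
    (\<lambda>e. \<exists>i j. f e = \<omega> ^ i \<and> g e = \<omega> ^ j \<and> h e = \<omega> ^ (i * j))"
  unfolding eq_omega_power_mult_iff[OF assms(1)]
  by (intro definable_exists_forall_intros definable_exists_forall_consecutive_lcm
      definable_exists_forall_qf definable_qf_omega_power definable_qf_intros assms(1))
    (auto simp: assms(2) terms[THEN definable_term_fun_upd] intro: terms[THEN definable_term_mono])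

lemma definable_exists_forall_add_exponents:
  assumes "l > 1" "definable_term (\<Omega> l) A f" "definable_term (\<Omega> l) A g" "definable_term (\<Omega> l) A h"
  shows "definable_exists_forall (\<Omega> l) 4 A
    (\<lambda>e. \<exists>i j. f e = \<omega> ^ i \<and> g e = \<omega> ^ j \<and> h e = \<omega> ^ (i + j))"
proof -
  have "(\<exists>i j. f e = \<omega> ^ i \<and> g e = \<omega> ^ j \<and> h e = \<omega> ^ (i + j)) \<longleftrightarrow>
      (\<exists>i. f e = \<omega> ^ i) \<and> (\<exists>j. g e = \<omega> ^ j) \<and> h e = f e * g e" for e
    by (auto simp: power_add)
  then show ?thesis
    by (simp only:) (intro definable_exists_forall_qf definable_qf_omega_power definable_qf_intros
        domain_omega_structure_neq_empty assms)
qed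


section \<open>Definability of Diophantine equations\<close>

lemma nat_structure_simps [simp]:
  "bin_of nat_structure NPlus = (+)"
  "bin_of nat_structure NTimes = (*)"
  "const_of nat_structure NZero = 0"
  "const_of nat_structure NOne = 1"
  by (simp_all add: nat_structure_def)

lemma definable_exists_forall_op_exponents:
  assumes "l > 1" "finite A"
    and "definable_term (\<Omega> l) A f" "definable_term (\<Omega> l) A g" "definable_term (\<Omega> l) A h"
  shows "definable_exists_forall (\<Omega> l) 4 A
    (\<lambda>e. \<exists>i j. f e = \<omega> ^ i \<and> g e = \<omega> ^ j \<and> h e = \<omega> ^ bin_of nat_structure b i j)"
  using definable_exists_forall_add_exponents[OF assms(1,3-5)]
    definable_exists_forall_mult_exponents[OF assms]
  by (cases b) simp_all

definition omega_add_one_log :: "'a ordinal \<Rightarrow> nat" where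
  "omega_add_one_log = inv ((^) (\<omega> + 1))"

lemma omega_add_one_log_power [simp]: "omega_add_one_log ((\<omega> + 1) ^ n) = n"
proof -
  have "1 < \<omega> + (1 :: 'a ordinal)" by (simp add: less_add_one_ordinal_iff less_imp_le)
  then have "inj ((^) (\<omega> + 1 :: 'a ordinal))" by (simp add: inj_on_def ordinal_power_inject)
  then show ?thesis unfolding omega_add_one_log_def by (rule inv_f_f)
qed

lemma power_omega_add_one_log: "\<xi> \<in> range ((^) (\<omega> + 1)) \<Longrightarrow> (\<omega> + 1) ^ omega_add_one_log \<xi> = \<xi>"
  by auto

definition evaluates_to :: "(nat \<Rightarrow> 'a ordinal) \<Rightarrow> (nat_const, nat_op) trm \<Rightarrow> 'a ordinal \<Rightarrow> bool" where
  "evaluates_to e t \<kappa> \<longleftrightarrow> (\<forall>i\<in>trm_vars t. e i \<in> range ((^) (\<omega> + 1))) \<and>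
     \<kappa> = \<omega> ^ val nat_structure (omega_add_one_log \<circ> e) t"

lemma evaluates_to_fun_upd:
  assumes "trm_vars t \<subseteq> A" "i \<notin> A"
  shows "evaluates_to (e(i := \<alpha>)) t \<kappa> \<longleftrightarrow> evaluates_to e t \<kappa>"
proof -
  have "i \<notin> trm_vars t" using assms by blast
  moreover from this have "\<forall>j\<in>trm_vars t. (e(i := \<alpha>)) j = e j" by auto
  ultimately show ?thesis
    by (simp add: evaluates_to_def fun_upd_comp val_fun_upd_fresh del: fun_upd_apply)
qed

lemma evaluates_to_Var_iff:
  "evaluates_to e (Var i) \<kappa> \<longleftrightarrow>
     e i * (\<omega> + 1) = (\<omega> + 1) * e i \<and> (\<exists>k. \<kappa> = \<omega> ^ k \<and> has_degree (e i) k)"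
proof -
  have "evaluates_to e (Var i) \<kappa> \<longleftrightarrow> (\<exists>k. \<kappa> = \<omega> ^ k \<and> e i = (\<omega> + 1) ^ k)"
    by (auto simp: evaluates_to_def)
  then show ?thesis unfolding eq_power_omega_add_one_iff by blast
qed

lemma evaluates_to_Bin_iff:
  assumes "l > 1"
  shows "evaluates_to e (Bin b s t) \<kappa> \<longleftrightarrow>
    (\<exists>\<alpha>\<in>domain (\<Omega> l). \<exists>\<beta>\<in>domain (\<Omega> l). evaluates_to e s \<alpha> \<and> evaluates_to e t \<beta> \<and>
       (\<exists>i j. \<alpha> = \<omega> ^ i \<and> \<beta> = \<omega> ^ j \<and> \<kappa> = \<omega> ^ bin_of nat_structure b i j))"
  using omega_power_in_domain[OF assms] by (auto simp: evaluates_to_def)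

lemma definable_exists_forall_evaluates_to:
  assumes "l > 1" "finite A" "trm_vars t \<subseteq> A" "definable_term (\<Omega> l) A f"
  shows "definable_exists_forall (\<Omega> l) 4 A (\<lambda>e. evaluates_to e t (f e))"
  using assms(2-)
proof (induction t arbitrary: A f)
  case (Var i)
  then show ?case
    unfolding evaluates_to_Var_iff
    by (intro definable_exists_forall_qf definable_qf_has_degree definable_qf_intros
        domain_omega_structure_neq_empty assms(1)) auto
next
  case (Const c)
  have "definable_exists_forall (\<Omega> l) 4 A (\<lambda>e. f e = 1)"
    "definable_exists_forall (\<Omega> l) 4 A (\<lambda>e. f e = \<omega>)"
    by (intro definable_exists_forall_qf definable_qf_intros
        domain_omega_structure_neq_empty assms(1) Const.prems)+
  then show ?case by (cases c) (simp_all add: evaluates_to_def)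
next
  case (Bin b s t)
  have vars: "trm_vars s \<subseteq> A" "trm_vars t \<subseteq> A" using Bin.prems(2) by auto
  show ?case
    unfolding evaluates_to_Bin_iff[OF assms(1)]
    by (intro definable_exists_forall_intros definable_exists_forall_op_exponents Bin.IH
        definable_term_var assms(1))
      (use Bin.prems in \<open>auto simp: vars[THEN evaluates_to_fun_upd] definable_term_fun_upd
        intro: definable_term_mono\<close>)
qed

lemma definable_exists_forall_diophantine:
  fixes l :: "'a ordinal"
  assumes "l > 1" "atomic_fm E" "free_vars E \<subseteq> {..<p}"
  shows "definable_exists_forall (\<Omega> l) 4 {..<p}
    (\<lambda>e. (\<forall>i\<in>{..<p}. e i \<in> range ((^) (\<omega> + 1))) \<and> sat nat_structure (omega_add_one_log \<circ> e) E)"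
proof -
  let ?D = "domain (\<Omega> l)"
  obtain s t where E: "E = Eq s t" using assms(2) unfolding atomic_fm_def by blast
  have vars: "trm_vars s \<subseteq> {..<p}" "trm_vars t \<subseteq> {..<p}" using assms(3) by (auto simp: E)
  have "(\<forall>i\<in>{..<p}. e i \<in> range ((^) (\<omega> + 1))) \<and> sat nat_structure (omega_add_one_log \<circ> e) E \<longleftrightarrow>
      (\<forall>i\<in>{..<p}. \<exists>\<kappa>\<in>?D. evaluates_to e (Var i) \<kappa>) \<and>
      (\<exists>\<kappa>\<in>?D. evaluates_to e s \<kappa> \<and> evaluates_to e t \<kappa>)" for e
    using vars omega_power_in_domain[OF assms(1)] by (auto simp: E evaluates_to_def)
  moreover have "definable_exists_forall (\<Omega> l) 4 {..<p} (\<lambda>e.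
      (\<forall>i\<in>{..<p}. \<exists>\<kappa>\<in>?D. evaluates_to e (Var i) \<kappa>) \<and>
      (\<exists>\<kappa>\<in>?D. evaluates_to e s \<kappa> \<and> evaluates_to e t \<kappa>))"
    by (intro definable_exists_forall_finite_ball definable_exists_forall_intros
        definable_exists_forall_evaluates_to definable_term_var assms(1))
      (use vars in \<open>auto simp: vars[THEN evaluates_to_fun_upd]
        evaluates_to_fun_upd[of "Var i" "{..<p}" for i]\<close>)
  ultimately show ?thesis by simp
qed

lemma EQ_rel_eq:
  fixes l :: "'a ordinal"
  assumes "l > 1" "atomic_fm E" "free_vars E \<subseteq> {..<p}"
  shows "EQ_rel p E = {xs. length xs = p \<and> set xs \<subseteq> domain (\<Omega> l) \<and>
    (\<forall>i\<in>{..<p}. xs ! i \<in> range ((^) (\<omega> + 1))) \<and> sat nat_structure (omega_add_one_log \<circ> (!) xs) E}"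
    (is "_ = ?R")
proof -
  let ?pow = "\<lambda>js. map (\<lambda>j. (\<omega> + 1 :: 'a ordinal) ^ j) js"
  have sat_pow: "sat nat_structure (omega_add_one_log \<circ> (!) (?pow js)) E \<longleftrightarrow>
      sat nat_structure ((!) js) E" if "length js = p" for js
    using assms(2,3) that val_cong[of _ "omega_add_one_log \<circ> (!) (?pow js)" "(!) js" nat_structure]
    unfolding atomic_fm_def by (fastforce simp: subset_iff)
  have "(\<omega> + 1) ^ j \<in> domain (\<Omega> l)" for j
    using eq_power_omega_add_one_iff[of "(\<omega> + 1) ^ j" j] has_degree_in_domain[OF assms(1)] by blast
  then have "?pow js \<in> ?R" if "length js = p" "sat nat_structure ((!) js) E" for js
    using that sat_pow by auto
  moreover have "\<exists>js. xs = ?pow js \<and> length js = p \<and> sat nat_structure ((!) js) E"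
    if "xs \<in> ?R" for xs
  proof -
    define js where "js = map omega_add_one_log xs"
    have "length js = p" using \<open>xs \<in> ?R\<close> by (simp add: js_def)
    moreover have "xs = ?pow js"
      using \<open>xs \<in> ?R\<close> by (intro nth_equalityI) (auto simp: js_def power_omega_add_one_log)
    ultimately show ?thesis using \<open>xs \<in> ?R\<close> sat_pow[of js] by blast
  qed
  ultimately show ?thesis unfolding EQ_rel_def by blast
qed

theorem mainTheorem10:
  fixes l :: "'a ordinal" and p :: nat and E :: "(nat_const, nat_op) fm"
  assumes "l > 1"
    and "atomic_fm E" and "free_vars E \<subseteq> {..<p}"
  shows "\<exists>m \<Phi>. exists_forall_form m 6 \<Phi> \<and>
           defines_relation (omega_structure l) p \<Phi> (EQ_rel p E)"
proof -
  let ?P = "\<lambda>e. (\<forall>i\<in>{..<p}. e i \<in> range ((^) (\<omega> + 1))) \<and> sat nat_structure (omega_add_one_log \<circ> e) E"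
  have "definable_exists_forall (\<Omega> l) 4 {..<p} ?P"
    using assms by (rule definable_exists_forall_diophantine)
  then have "definable_exists_forall (\<Omega> l) 6 {..<p} ?P"
    using domain_omega_structure_neq_empty[OF assms(1)] definable_exists_forall_mono[of _ 4 6] by simp
  then show ?thesis
    unfolding EQ_rel_eq[OF assms] by (rule definable_exists_forall_imp_defines_relation)
qed

end
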